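(* The AEL threshold problem is EXPSPACE-hard, even when the threshold is fixed to $t=0$.
   Context: A weighted game is a tuple $G=(S_0,S_1,E)$ where $S_0,S_1$ are finite disjoint sets of states owned by players $P_0$ and $P_1$, $S=S_0\cup S_1$, and $E\subseteq S\times[-W,W]\times S$ (for some $W\in\mathbb N$) is a finite set of integer-weighted edges; every state has at least one outgoing edge. A play from $s$ is an infinite sequence of edges $e_1e_2\cdots$ with $\mathrm{src}(e_1)=s$ and $\mathrm{tgt}(e_i)=\mathrm{src}(e_{i+1})$; a prefix is a finite such sequence. For a nonempty prefix $\rho=e_1\cdots e_n$, $\mathrm{EL}(\rho)=\sum_{i=1}^n w(e_i)$ and $\mathrm{AE}(\rho)=\frac1n\sum_{i=1}^n\mathrm{EL}(e_1\cdots e_i)$; for a play $\pi$, $\overline{\mathrm{AE}}(\pi)=\limsup_{n\to\infty}\mathrm{AE}(\pi_{\le n})$. A strategy of $P_i$ maps every prefix ending in a state of $S_i$ to an outgoing edge of that state; it is winning for $P_0$ for an objective if all its outcomes belong to the objective. For $t\in\mathbb Q$, $\mathrm{AEL}(t)$ is the set of plays $\pi$ with $\mathrm{EL}(\pi_{\le n})\ge0$ for all $n\ge1$ and $\overline{\mathrm{AE}}(\pi)\le t$. The AEL threshold problem: given a finite weighted game $G$ with weights in binary, an initial state $s_{\mathrm{init}}$ and a threshold $t=t_1/t_2$ ($t_1,t_2\in\mathbb N$ in binary), decide whether $P_0$ has a winning strategy from $s_{\mathrm{init}}$ for $\mathrm{AEL}(t)$. *)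

theory Defs
  imports
    Complex_Main
    "HOL-Library.Extended_Real"
    "HOL-Computational_Algebra.Polynomial"
begin

section \<open>Weighted games and the average-energy objective\<close>

record 'a game =
  states0 :: "'a set"
  states1 :: "'a set"
  edges :: "('a \<times> int \<times> 'a) set"

definition states :: "'a game \<Rightarrow> 'a set" where
  "states G = states0 G \<union> states1 G"

definition src :: "'a \<times> int \<times> 'a \<Rightarrow> 'a" where
  "src e = fst e"

definition weight :: "'a \<times> int \<times> 'a \<Rightarrow> int" where
  "weight e = fst (snd e)"

definition tgt :: "'a \<times> int \<times> 'a \<Rightarrow> 'a" where
  "tgt e = snd (snd e)"

definition weighted_game :: "'a game \<Rightarrow> bool" where
  "weighted_game G \<longleftrightarrow>
     finite (states0 G) \<and> finite (states1 G) \<and> states0 G \<inter> states1 G = {} \<and>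
     finite (edges G) \<and>
     (\<exists>W :: nat. edges G \<subseteq> states G \<times> {- int W..int W} \<times> states G) \<and>
     (\<forall>s \<in> states G. \<exists>e \<in> edges G. src e = s)"

definition is_play :: "'a game \<Rightarrow> 'a \<Rightarrow> (nat \<Rightarrow> 'a \<times> int \<times> 'a) \<Rightarrow> bool" where
  "is_play G s \<pi> \<longleftrightarrow>
     src (\<pi> 0) = s \<and> (\<forall>i. \<pi> i \<in> edges G \<and> tgt (\<pi> i) = src (\<pi> (Suc i)))"

definition is_prefix :: "'a game \<Rightarrow> 'a \<Rightarrow> ('a \<times> int \<times> 'a) list \<Rightarrow> bool" where
  "is_prefix G s \<rho> \<longleftrightarrow>
     set \<rho> \<subseteq> edges G \<and>
     (\<rho> \<noteq> [] \<longrightarrow> src (hd \<rho>) = s) \<and>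
     (\<forall>i. Suc i < length \<rho> \<longrightarrow> tgt (\<rho> ! i) = src (\<rho> ! Suc i))"

text \<open>The empty prefix ends in the state where the play starts.\<close>

definition end_state :: "'a \<Rightarrow> ('a \<times> int \<times> 'a) list \<Rightarrow> 'a" where
  "end_state s \<rho> = (if \<rho> = [] then s else tgt (last \<rho>))"

definition play_prefix :: "(nat \<Rightarrow> 'e) \<Rightarrow> nat \<Rightarrow> 'e list" where
  "play_prefix \<pi> n = map \<pi> [0..<n]"

text \<open>A strategy, for plays from \<open>s\<close>, of the player who owns the states \<open>V\<close>.
  Its values on prefixes ending outside \<open>V\<close> are irrelevant.\<close>

definition is_strategy ::
    "'a game \<Rightarrow> 'a set \<Rightarrow> 'a \<Rightarrow> (('a \<times> int \<times> 'a) list \<Rightarrow> 'a \<times> int \<times> 'a) \<Rightarrow> bool" where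
  "is_strategy G V s \<sigma> \<longleftrightarrow>
     (\<forall>\<rho>. is_prefix G s \<rho> \<and> end_state s \<rho> \<in> V \<longrightarrow>
          \<sigma> \<rho> \<in> edges G \<and> src (\<sigma> \<rho>) = end_state s \<rho>)"

definition outcomes ::
    "'a game \<Rightarrow> 'a set \<Rightarrow> 'a \<Rightarrow> (('a \<times> int \<times> 'a) list \<Rightarrow> 'a \<times> int \<times> 'a)
      \<Rightarrow> (nat \<Rightarrow> 'a \<times> int \<times> 'a) set" where
  "outcomes G V s \<sigma> =
     {\<pi>. is_play G s \<pi> \<and>
         (\<forall>n. end_state s (play_prefix \<pi> n) \<in> V \<longrightarrow> \<pi> n = \<sigma> (play_prefix \<pi> n))}"

definition P0_wins :: "'a game \<Rightarrow> 'a \<Rightarrow> (nat \<Rightarrow> 'a \<times> int \<times> 'a) set \<Rightarrow> bool" where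
  "P0_wins G s Obj \<longleftrightarrow>
     (\<exists>\<sigma>. is_strategy G (states0 G) s \<sigma> \<and> outcomes G (states0 G) s \<sigma> \<subseteq> Obj)"

definition EL :: "('a \<times> int \<times> 'a) list \<Rightarrow> int" where
  "EL \<rho> = (\<Sum>e\<leftarrow>\<rho>. weight e)"

definition AE :: "('a \<times> int \<times> 'a) list \<Rightarrow> real" where
  "AE \<rho> = (\<Sum>i = 1..length \<rho>. real_of_int (EL (take i \<rho>))) / real (length \<rho>)"

definition AE_sup :: "(nat \<Rightarrow> 'a \<times> int \<times> 'a) \<Rightarrow> ereal" where
  "AE_sup \<pi> = limsup (\<lambda>n. ereal (AE (play_prefix \<pi> n)))"

definition AEL :: "'a game \<Rightarrow> rat \<Rightarrow> (nat \<Rightarrow> 'a \<times> int \<times> 'a) set" where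
  "AEL G t =
     {\<pi>. (\<exists>s \<in> states G. is_play G s \<pi>) \<and>
         (\<forall>n \<ge> 1. EL (play_prefix \<pi> n) \<ge> 0) \<and>
         AE_sup \<pi> \<le> ereal (of_rat t)}"


section \<open>Binary encoding of instances\<close>

text \<open>All encodings are prefix-free, so they can be concatenated without separators.
  Numbers are written in binary, least significant bit first and without leading zeros.\<close>

fun bits :: "nat \<Rightarrow> bool list" where
  "bits n = (if n = 0 then [] else odd n # bits (n div 2))"

declare bits.simps [simp del]

fun enc_list :: "('a \<Rightarrow> bool list) \<Rightarrow> 'a list \<Rightarrow> bool list" where
  "enc_list f [] = [False]"
| "enc_list f (x # xs) = True # f x @ enc_list f xs"

definition enc_nat :: "nat \<Rightarrow> bool list" where
  "enc_nat n = enc_list (\<lambda>b. [b]) (bits n)"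

definition enc_int :: "int \<Rightarrow> bool list" where
  "enc_int z = (z < 0) # enc_nat (nat \<bar>z\<bar>)"

definition enc_edge :: "nat \<times> int \<times> nat \<Rightarrow> bool list" where
  "enc_edge e = enc_nat (src e) @ enc_int (weight e) @ enc_nat (tgt e)"

text \<open>The states of an input game are natural numbers, and its three finite sets are
  presented as lists.\<close>

type_synonym game_input = "nat list \<times> nat list \<times> (nat \<times> int \<times> nat) list"

fun game_of :: "game_input \<Rightarrow> nat game" where
  "game_of (vs0, vs1, es) = \<lparr>states0 = set vs0, states1 = set vs1, edges = set es\<rparr>"

fun enc_game :: "game_input \<Rightarrow> bool list" where
  "enc_game (vs0, vs1, es) =
     enc_list enc_nat vs0 @ enc_list enc_nat vs1 @ enc_list enc_edge es"

text \<open>The decoding is unique:\<close>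

lemma enc_list_prefix_free:
  assumes f: "\<And>x y u v. f x @ u = f y @ v \<longleftrightarrow> x = y \<and> u = v"
  shows "enc_list f xs @ u = enc_list f ys @ v \<longleftrightarrow> xs = ys \<and> u = v"
proof (induction xs arbitrary: ys)
  case Nil
  show ?case by (cases ys) simp_all
next
  case (Cons x xs)
  show ?case by (cases ys) (simp_all add: f Cons.IH)
qed

lemma bits_inject: "bits m = bits n \<longleftrightarrow> m = n"
proof (induction m arbitrary: n rule: less_induct)
  case (less m)
  have bits_0: "bits 0 = []"
    by (subst bits.simps) simp
  have bits_pos: "bits k = odd k # bits (k div 2)" if "k > 0" for k
    using that by (subst bits.simps) simp
  consider "m = 0" "n = 0" | "m = 0" "n > 0" | "m > 0" "n = 0" | "m > 0" "n > 0"
    by auto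
  then show ?case
  proof cases
    case 4
    have IH: "bits (m div 2) = bits (n div 2) \<longleftrightarrow> m div 2 = n div 2"
      using 4 by (intro less) simp
    have "bits m = bits n \<longleftrightarrow> odd m = odd n \<and> m div 2 = n div 2"
      unfolding bits_pos [OF 4(1)] bits_pos [OF 4(2)] by (simp add: IH)
    also have "\<dots> \<longleftrightarrow> m = n"
      by presburger
    finally show ?thesis .
  qed (simp_all add: bits_0 bits_pos)
qed

lemma enc_nat_prefix_free: "enc_nat m @ u = enc_nat n @ v \<longleftrightarrow> m = n \<and> u = v"
proof -
  have "[b] @ x = [c] @ y \<longleftrightarrow> b = c \<and> x = y" for b c :: bool and x y
    by simp
  from enc_list_prefix_free [of "\<lambda>b. [b]", OF this] show ?thesis
    by (simp add: enc_nat_def bits_inject)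
qed

lemma enc_int_prefix_free: "enc_int y @ u = enc_int z @ v \<longleftrightarrow> y = z \<and> u = v"
proof -
  have "(y < 0) = (z < 0) \<and> nat \<bar>y\<bar> = nat \<bar>z\<bar> \<longleftrightarrow> y = z"
    by arith
  then show ?thesis
    by (simp add: enc_int_def enc_nat_prefix_free) blast
qed

lemma enc_edge_prefix_free: "enc_edge d @ u = enc_edge e @ v \<longleftrightarrow> d = e \<and> u = v"
  by (cases d; cases e)
    (simp add: enc_edge_def src_def weight_def tgt_def enc_nat_prefix_free enc_int_prefix_free)

lemma enc_game_prefix_free: "enc_game g @ u = enc_game h @ v \<longleftrightarrow> g = h \<and> u = v"
  by (cases g; cases h)
    (simp add: enc_list_prefix_free [of enc_nat, OF enc_nat_prefix_free]
      enc_list_prefix_free [of enc_edge, OF enc_edge_prefix_free])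


section \<open>The average-energy threshold problem\<close>

definition AEL_threshold_problem :: "bool list set" where
  "AEL_threshold_problem =
     {enc_game g @ enc_nat s @ enc_nat t1 @ enc_nat t2 | g s t1 t2.
        weighted_game (game_of g) \<and> s \<in> states (game_of g) \<and> t2 > 0 \<and>
        P0_wins (game_of g) s (AEL (game_of g) (of_nat t1 / of_nat t2))}"

text \<open>With a fixed threshold, the threshold is not part of the input.\<close>

definition AEL_threshold_problem_at :: "rat \<Rightarrow> bool list set" where
  "AEL_threshold_problem_at t =
     {enc_game g @ enc_nat s | g s.
        weighted_game (game_of g) \<and> s \<in> states (game_of g) \<and>
        P0_wins (game_of g) s (AEL (game_of g) t)}"


section \<open>Turing machines\<close>

text \<open>Deterministic machines with one-way infinite tapes. Initially cell 0 of every tape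
  holds the symbol 1 (the left end), tape 0 holds the input in the cells from 1 on (symbols
  2 and 3 for the two bits), and every other cell holds the symbol 0 (blank).
  The first component of a tape is its contents and the second its head position.
  A move to the left from cell 0 has no effect. The initial state is 0.\<close>

datatype dir = Lft | Stay | Rgt

record tm =
  num_tapes :: nat
  num_syms :: nat
  num_states :: nat
  accept :: nat
  reject :: nat
  trans :: "nat \<Rightarrow> nat list \<Rightarrow> nat \<times> (nat \<times> dir) list"

definition turing_machine :: "tm \<Rightarrow> bool" where
  "turing_machine M \<longleftrightarrow>
     num_tapes M \<ge> 1 \<and> num_syms M \<ge> 4 \<and> 0 < num_states M \<and>
     accept M < num_states M \<and> reject M < num_states M \<and> accept M \<noteq> reject M \<and>
     (\<forall>q < num_states M. \<forall>as. length as = num_tapes M \<and> (\<forall>a \<in> set as. a < num_syms M) \<longrightarrow>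
        (case trans M q as of (q', acts) \<Rightarrow>
           q' < num_states M \<and> length acts = num_tapes M \<and>
           (\<forall>(a, d) \<in> set acts. a < num_syms M)))"

type_synonym tape = "(nat \<Rightarrow> nat) \<times> nat"
type_synonym config = "nat \<times> tape list"

fun read :: "tape \<Rightarrow> nat" where
  "read (c, p) = c p"

fun move :: "dir \<Rightarrow> nat \<Rightarrow> nat" where
  "move Lft p = p - 1"
| "move Stay p = p"
| "move Rgt p = p + 1"

fun act :: "nat \<times> dir \<Rightarrow> tape \<Rightarrow> tape" where
  "act (a, d) (c, p) = (c(p := a), move d p)"

definition halted :: "tm \<Rightarrow> config \<Rightarrow> bool" where
  "halted M cfg \<longleftrightarrow> fst cfg = accept M \<or> fst cfg = reject M"

definition step :: "tm \<Rightarrow> config \<Rightarrow> config" where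
  "step M cfg =
     (if halted M cfg then cfg
      else case trans M (fst cfg) (map read (snd cfg)) of
        (q, acts) \<Rightarrow> (q, map2 act acts (snd cfg)))"

definition contents :: "bool list \<Rightarrow> nat \<Rightarrow> nat" where
  "contents x i =
     (if i = 0 then 1 else if i \<le> length x then (if x ! (i - 1) then 3 else 2) else 0)"

definition init :: "tm \<Rightarrow> bool list \<Rightarrow> config" where
  "init M x = (0, (contents x, 0) # replicate (num_tapes M - 1) (contents [], 0))"

definition run :: "tm \<Rightarrow> bool list \<Rightarrow> nat \<Rightarrow> config" where
  "run M x n = (step M ^^ n) (init M x)"


section \<open>Hardness for exponential space\<close>

definition decides :: "tm \<Rightarrow> bool list set \<Rightarrow> bool" where
  "decides M L \<longleftrightarrow>
     (\<forall>x. \<exists>n. fst (run M x n) = (if x \<in> L then accept M else reject M))"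

definition space_bounded :: "tm \<Rightarrow> (nat \<Rightarrow> nat) \<Rightarrow> bool" where
  "space_bounded M S \<longleftrightarrow>
     (\<forall>x n. \<forall>\<tau> \<in> set (snd (run M x n)). snd \<tau> \<le> S (length x))"

text \<open>As usual, space complexity is measured on machines with a single tape;
  for bounds that are at least linear, further tapes yield the same class.\<close>

definition EXPSPACE :: "bool list set set" where
  "EXPSPACE =
     {L. \<exists>M. \<exists>p :: nat poly. turing_machine M \<and> num_tapes M = 1 \<and>
           decides M L \<and> space_bounded M (\<lambda>n. 2 ^ poly p n)}"

text \<open>The last tape is the output tape.\<close>

definition computes_in_time :: "tm \<Rightarrow> (bool list \<Rightarrow> bool list) \<Rightarrow> (nat \<Rightarrow> nat) \<Rightarrow> bool" where
  "computes_in_time M f T \<longleftrightarrow>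
     (\<forall>x. \<exists>n \<le> T (length x). halted M (run M x n) \<and>
            fst (last (snd (run M x n))) = contents (f x))"

definition polytime :: "(bool list \<Rightarrow> bool list) \<Rightarrow> bool" where
  "polytime f \<longleftrightarrow>
     (\<exists>M. \<exists>p :: nat poly. turing_machine M \<and> computes_in_time M f (poly p))"

definition polytime_reducible :: "bool list set \<Rightarrow> bool list set \<Rightarrow> bool" where
  "polytime_reducible A B \<longleftrightarrow> (\<exists>f. polytime f \<and> (\<forall>x. x \<in> A \<longleftrightarrow> f x \<in> B))"

definition EXPSPACE_hard :: "bool list set \<Rightarrow> bool" where
  "EXPSPACE_hard B \<longleftrightarrow> (\<forall>A \<in> EXPSPACE. polytime_reducible A B)"

end

theory Submission
  imports Defs "HOL-Library.Nat_Bijection"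
begin

text \<open>
  Fix a machine \<open>M\<close> with space bound $2^{p(n)}$. Let \<open>K\<close> be $2^{m+1}-1$ for a polynomially bounded
  $m \ge p(n)$, and write the configurations of \<open>M\<close>, each of \<open>K\<close> cells, one after the other in an
  infinite word \<open>w\<close>, preceded by a dummy blank. With $D = K + 1$, locality of the machine gives
  $w_{c+D} = F(w_c, w_{c+1}, w_{c+2})$, so that one integer \<open>c\<close> encodes both time and position.

  In the game the energy is \<open>2 * c + 1\<close>, and in the vertex \<open>Claim a\<close> player 0 asserts that $w_c = a$.
  To defend the claim she subtracts $D$ from \<open>c\<close> and names the three symbols that yield \<open>a\<close>; player 1
  picks the one she has to defend next. If \<open>c\<close> is below $D$, then she must verify the initial
  configuration: a chain of vertices compares \<open>c\<close> with the positions of the input bits, and another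
  one, with weights $-2^k$, handles the blanks. At the beginning player 0 chooses \<open>c\<close> and claims an
  accepting symbol. The energy is odd until it drops by a final odd amount into a sink, where it must
  be 0. Hence it is at least 1 in any play that does not reach the sink with energy 0, and the average
  energy is 0 only in plays that do.

  The reduction is written in a small language of append-only loop programs, compiled to Turing
  machines. Tapes only grow, so the final lengths of the tapes that control loops bound the running
  time. The numbers of the vertices, and the absolute values of the weights that depend on the input,
  have the form $2^j (2 t + 1)$; the code of such a number consists of \<open>j\<close> copies of \<open>10\<close>
  followed by a word that depends only on \<open>t\<close>.
\<close>

section \<open>Plays that reach or avoid energy zero\<close>

lemma play_prefix_0 [simp]: "play_prefix \<pi> 0 = []"
  by (simp add: play_prefix_def)

lemma play_prefix_Suc: "play_prefix \<pi> (Suc n) = play_prefix \<pi> n @ [\<pi> n]"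
  by (simp add: play_prefix_def)

lemma length_play_prefix [simp]: "length (play_prefix \<pi> n) = n"
  by (simp add: play_prefix_def)

lemma take_play_prefix: "i \<le> n \<Longrightarrow> take i (play_prefix \<pi> n) = play_prefix \<pi> i"
  by (simp add: play_prefix_def take_map)

lemma EL_Nil [simp]: "EL [] = 0"
  by (simp add: EL_def)

lemma EL_snoc [simp]: "EL (\<rho> @ [e]) = EL \<rho> + weight e"
  by (simp add: EL_def)

lemma end_state_Nil [simp]: "end_state s [] = s"
  by (simp add: end_state_def)

lemma end_state_snoc [simp]: "end_state s (\<rho> @ [e]) = tgt e"
  by (simp add: end_state_def)

lemma AE_play_prefix:
  "AE (play_prefix \<pi> n) = (\<Sum>i = 1..n. real_of_int (EL (play_prefix \<pi> i))) / real n"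
  by (simp add: AE_def take_play_prefix)

lemma end_state_play_prefix:
  "is_play G s \<pi> \<Longrightarrow> end_state s (play_prefix \<pi> n) = src (\<pi> n)"
  by (cases n) (auto simp: is_play_def play_prefix_Suc)

lemma is_prefix_snoc:
  assumes "is_prefix G s \<rho>" "e \<in> edges G" "src e = end_state s \<rho>"
  shows "is_prefix G s (\<rho> @ [e])"
  unfolding is_prefix_def
proof (intro conjI allI impI)
  show "set (\<rho> @ [e]) \<subseteq> edges G"
    using assms by (simp add: is_prefix_def)
  show "src (hd (\<rho> @ [e])) = s"
    using assms by (cases "\<rho> = []") (simp_all add: is_prefix_def)
  fix i assume i: "Suc i < length (\<rho> @ [e])"
  show "tgt ((\<rho> @ [e]) ! i) = src ((\<rho> @ [e]) ! Suc i)"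
  proof (cases "Suc i = length \<rho>")
    case True
    then have "\<rho> \<noteq> []" "i = length \<rho> - 1"
      by auto
    then show ?thesis
      using True assms(3) by (simp add: nth_append last_conv_nth end_state_def)
  next
    case False
    then show ?thesis
      using i assms(1) by (simp add: nth_append is_prefix_def)
  qed
qed

section \<open>Average energy of plays that end at energy 0 or stay positive\<close>

lemma AE_sup_eventually_0:
  assumes "\<And>n. n \<ge> N \<Longrightarrow> EL (play_prefix \<pi> n) = 0"
  shows "AE_sup \<pi> = 0"
proof -
  \<comment> \<open>From \<open>N\<close> on the numerator of the average is the constant
    \<open>S\<close>, so the averages tend to 0 however large the energy was before.\<close>
  define S where "S = (\<Sum>i = 1..N. real_of_int (EL (play_prefix \<pi> i)))"
  have "AE (play_prefix \<pi> n) = S / real n" if "n \<ge> N" for n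
  proof -
    have "{1..n} = {1..N} \<union> {N+1..n}"
      using that by auto
    then have "(\<Sum>i = 1..n. real_of_int (EL (play_prefix \<pi> i))) = S +
        (\<Sum>i = N+1..n. real_of_int (EL (play_prefix \<pi> i)))"
      by (simp add: S_def sum.union_disjoint)
    also have "(\<Sum>i = N+1..n. real_of_int (EL (play_prefix \<pi> i))) = 0"
      by (intro sum.neutral) (use assms in auto)
    finally show ?thesis
      by (simp add: AE_play_prefix)
  qed
  then have ev: "eventually (\<lambda>n. S / real n = AE (play_prefix \<pi> n)) sequentially"
    by (auto simp: eventually_sequentially intro!: exI [of _ N])
  have "(\<lambda>n. S / real n) \<longlonglongrightarrow> 0"
    by (rule lim_const_over_n)
  then have "(\<lambda>n. AE (play_prefix \<pi> n)) \<longlonglongrightarrow> 0"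
    using ev by (rule Lim_transform_eventually)
  then have "(\<lambda>n. ereal (AE (play_prefix \<pi> n))) \<longlonglongrightarrow> ereal 0"
    by simp
  then show ?thesis
    unfolding AE_sup_def by (simp add: lim_imp_Limsup zero_ereal_def)
qed

lemma AE_sup_ge_1:
  assumes "\<And>n. n \<ge> 1 \<Longrightarrow> EL (play_prefix \<pi> n) \<ge> 1"
  shows "AE_sup \<pi> \<ge> 1"
proof -
  have "AE (play_prefix \<pi> n) \<ge> 1" if "n \<ge> 1" for n
  proof -
    have "real n = (\<Sum>i = 1..n. 1)"
      by simp
    also have "\<dots> \<le> (\<Sum>i = 1..n. real_of_int (EL (play_prefix \<pi> i)))"
      by (intro sum_mono) (use assms in force)
    finally show ?thesis
      using that by (simp add: AE_play_prefix)
  qed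
  then have "eventually (\<lambda>n. (1::ereal) \<le> ereal (AE (play_prefix \<pi> n))) sequentially"
    by (auto simp: eventually_sequentially one_ereal_def intro!: exI [of _ 1])
  then show ?thesis
    unfolding AE_sup_def
    by (intro le_Limsup) simp_all
qed

text \<open>An attractor on pairs of a vertex and an energy level, with target \<open>z\<close> at
  energy 0, graded by a bound on the number of moves. The grade is the ranking function of player 0;
  a negative energy counts as failure.\<close>

inductive forced :: "'a game \<Rightarrow> 'a \<Rightarrow> nat \<Rightarrow> 'a \<Rightarrow> int \<Rightarrow> bool" for G z where
  forced_here: "forced G z n z 0"
| forced_0: "s \<in> states0 G \<Longrightarrow> (s, w, t) \<in> edges G \<Longrightarrow> e + w \<ge> 0 \<Longrightarrow> forced G z n t (e + w)
     \<Longrightarrow> forced G z (Suc n) s e"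
| forced_1: "s \<in> states1 G \<Longrightarrow>
     (\<And>w t. (s, w, t) \<in> edges G \<Longrightarrow> e + w \<ge> 0 \<and> forced G z n t (e + w))
     \<Longrightarrow> forced G z (Suc n) s e"

lemma forced_Suc: "forced G z n s e \<Longrightarrow> forced G z (Suc n) s e"
proof (induction rule: forced.induct)
  case (forced_1 s e n)
  then show ?case
    by (intro forced.forced_1) auto
qed (auto intro: forced.intros)

lemma forced_mono: "n \<le> n' \<Longrightarrow> forced G z n s e \<Longrightarrow> forced G z n' s e"
  by (induction n' rule: dec_induct) (auto intro: forced_Suc)

text \<open>Each move lowers the least bound until \<open>z\<close> is reached at energy 0. From
  there the loop \<open>(z, 0, z)\<close> keeps the energy at 0, and the average tends to 0.\<close>

lemma forced_P0_wins:
  assumes G: "weighted_game G" and s: "s \<in> states G"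
    and z: "z \<in> states0 G" "(z, 0, z) \<in> edges G"
    and forced: "forced G z N s 0"
  shows "P0_wins G s (AEL G 0)"
proof -
  define R where "R = (\<lambda>s e. LEAST n. forced G z n s e)"
  \<comment> \<open>Inside the attractor, player 0 has at least one good edge
    (\<open>step0\<close>), and every edge of player 1 is good (\<open>step1\<close>).\<close>
  define good where "good = (\<lambda>s e ed. ed \<in> edges G \<and> src ed = s \<and> e + weight ed \<ge> 0 \<and>
     (\<exists>n. forced G z n (tgt ed) (e + weight ed)) \<and>
     (s = z \<and> e = 0 \<longrightarrow> ed = (z, 0, z)) \<and>
     (\<not> (s = z \<and> e = 0) \<longrightarrow> R (tgt ed) (e + weight ed) < R s e))"
  have step0: "\<exists>ed. good s e ed" if "forced G z n s e" "s \<in> states0 G" for n s e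
  proof (cases "s = z \<and> e = 0")
    case True
    then show ?thesis
      using z that by (intro exI [of _ "(z, 0, z)"])
        (auto simp: good_def src_def tgt_def weight_def)
  next
    case False
    have "forced G z (R s e) s e"
      unfolding R_def using that(1) by (rule LeastI)
    then show ?thesis
    proof cases
      case (forced_0 w t k)
      moreover have "R t (e + w) \<le> k"
        unfolding R_def using forced_0 by (intro Least_le) auto
      ultimately show ?thesis
        using False by (intro exI [of _ "(s, w, t)"])
          (auto simp: good_def src_def tgt_def weight_def)
    next
      case (forced_1)
      then show ?thesis
        using that G by (auto simp: weighted_game_def)
    qed (use False in auto)
  qed
  have step1: "good s e ed" if f: "forced G z n s e" and s: "s \<in> states1 G"
    and ed: "ed \<in> edges G" "src ed = s" for n s e ed
  proof -
    have nz: "s \<noteq> z"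
      using s z G by (auto simp: weighted_game_def)
    have "forced G z (R s e) s e"
      unfolding R_def using f by (rule LeastI)
    then show ?thesis
    proof cases
      case (forced_1 k)
      have "(s, weight ed, tgt ed) \<in> edges G"
        using ed by (auto simp: src_def weight_def tgt_def)
      then have *: "e + weight ed \<ge> 0" "forced G z k (tgt ed) (e + weight ed)"
        using forced_1 by auto
      moreover have "R (tgt ed) (e + weight ed) \<le> k"
        unfolding R_def using * by (intro Least_le) auto
      ultimately show ?thesis
        using nz ed forced_1 by (auto simp: good_def)
    qed (use nz s G in \<open>auto simp: weighted_game_def\<close>)
  qed
  \<comment> \<open>The choice depends only on the last vertex and the energy of the prefix. Where
    no good edge exists, an arbitrary outgoing one is taken, so that \<open>is_strategy\<close>
    holds for all prefixes.\<close>
  define \<sigma> where "\<sigma> = (\<lambda>\<rho>. let q = end_state s \<rho> in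
     if \<exists>ed. good q (EL \<rho>) ed then SOME ed. good q (EL \<rho>) ed
     else SOME ed. ed \<in> edges G \<and> src ed = q)"
  have \<sigma>_good: "good (end_state s \<rho>) (EL \<rho>) (\<sigma> \<rho>)" if "\<exists>ed. good (end_state s \<rho>) (EL \<rho>) ed" for \<rho>
    using that unfolding \<sigma>_def Let_def by (simp add: someI_ex)
  have "is_strategy G (states0 G) s \<sigma>"
    unfolding is_strategy_def
  proof (intro allI impI)
    fix \<rho> assume \<rho>: "is_prefix G s \<rho> \<and> end_state s \<rho> \<in> states0 G"
    show "\<sigma> \<rho> \<in> edges G \<and> src (\<sigma> \<rho>) = end_state s \<rho>"
    proof (cases "\<exists>ed. good (end_state s \<rho>) (EL \<rho>) ed")
      case True
      from \<sigma>_good [OF True] show ?thesis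
        by (simp add: good_def)
    next
      case False
      have "\<exists>ed. ed \<in> edges G \<and> src ed = end_state s \<rho>"
        using \<rho> G unfolding weighted_game_def states_def by blast
      from someI_ex [OF this] show ?thesis
        using False by (simp add: \<sigma>_def)
    qed
  qed
  moreover have "outcomes G (states0 G) s \<sigma> \<subseteq> AEL G 0"
  proof
    fix \<pi> assume \<pi>: "\<pi> \<in> outcomes G (states0 G) s \<sigma>"
    then have play: "is_play G s \<pi>"
      by (simp add: outcomes_def)
    define E where "E = (\<lambda>n. EL (play_prefix \<pi> n))"
    define q where "q = (\<lambda>n. src (\<pi> n))"
    have q_Suc: "q (Suc n) = tgt (\<pi> n)" for n
      using play by (simp add: is_play_def q_def)
    have E_Suc: "E (Suc n) = E n + weight (\<pi> n)" for n
      by (simp add: E_def play_prefix_Suc)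
    have ed: "\<pi> n \<in> edges G" "src (\<pi> n) = q n" for n
      using play by (auto simp: is_play_def q_def)
    have qst: "q n \<in> states0 G \<or> q n \<in> states1 G" for n
      using ed [of n] G by (auto simp: weighted_game_def states_def src_def)
    have good_step: "good (q n) (E n) (\<pi> n)" if "\<exists>k. forced G z k (q n) (E n)" for n
    proof (cases "q n \<in> states0 G")
      case True
      have es: "end_state s (play_prefix \<pi> n) = q n"
        using end_state_play_prefix [OF play] by (simp add: q_def)
      then have "\<pi> n = \<sigma> (play_prefix \<pi> n)"
        using \<pi> True by (auto simp: outcomes_def)
      moreover have "\<exists>ed. good (q n) (E n) ed"
        using step0 that True by blast
      ultimately show ?thesis
        using \<sigma>_good [of "play_prefix \<pi> n"] es by (simp add: E_def)
    next
      case False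
      then show ?thesis
        using that qst ed step1 by blast
    qed
    have forced_all: "\<exists>k. forced G z k (q n) (E n)" for n
    proof (induction n)
      case 0
      then show ?case
        using forced play by (auto simp: E_def q_def is_play_def)
    next
      case (Suc n)
      from good_step [OF Suc] show ?case
        by (auto simp: good_def q_Suc E_Suc)
    qed
    have E_nonneg: "E n \<ge> 0" for n
    proof (cases n)
      case (Suc k)
      from good_step [OF forced_all, of k] show ?thesis
        by (auto simp: good_def Suc E_Suc)
    qed (simp add: E_def)
    \<comment> \<open>Otherwise \<open>R\<close> would decrease forever along the play.\<close>
    have "\<exists>n. q n = z \<and> E n = 0"
    proof (rule ccontr)
      assume "\<not> ?thesis"
      have "R (q (Suc n)) (E (Suc n)) < R (q n) (E n)" for n
        using \<open>\<not> (\<exists>n. q n = z \<and> E n = 0)\<close> good_step [OF forced_all, of n] by (auto simp: good_def q_Suc E_Suc)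
      then have dec: "R (q (Suc n)) (E (Suc n)) < R (q n) (E n)" for n .
      have "R (q n) (E n) + n \<le> R (q 0) (E 0)" for n
      proof (induction n)
        case (Suc n)
        then show ?case
          using dec [of n] by linarith
      qed simp
      from this [of "Suc (R (q 0) (E 0))"] show False
        by simp
    qed
    then obtain n0 where n0: "q n0 = z" "E n0 = 0"
      by blast
    have "q n = z \<and> E n = 0" if "n \<ge> n0" for n
      using that
    proof (induction n rule: dec_induct)
      case (step n)
      with good_step [OF forced_all, of n] have "\<pi> n = (z, 0, z)"
        by (simp add: good_def)
      with step show ?case
        by (simp add: q_Suc E_Suc tgt_def weight_def)
    qed (use n0 in simp)
    then have "AE_sup \<pi> = 0"
      by (intro AE_sup_eventually_0) (auto simp: E_def)
    then show "\<pi> \<in> AEL G 0"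
      using play s E_nonneg by (auto simp: AEL_def E_def zero_ereal_def)
  qed
  ultimately show ?thesis
    by (auto simp: P0_wins_def)
qed

text \<open>Player 1 maintains the invariant \<open>bad\<close>, under which a move leads either to
  a negative energy or to energy at least 1. Hence the play violates the lower bound or its upper
  average is at least 1.\<close>

lemma spoiled_not_P0_wins:
  assumes G: "weighted_game G" and s: "s \<in> states G"
    and bad: "bad s 0"
    and bad0: "\<And>q w t e. bad q e \<Longrightarrow> q \<in> states0 G \<Longrightarrow> (q, w, t) \<in> edges G \<Longrightarrow>
       e + w \<ge> 0 \<Longrightarrow> bad t (e + w) \<and> e + w \<ge> 1"
    and bad1: "\<And>q e. bad q e \<Longrightarrow> q \<in> states1 G \<Longrightarrow>
       \<exists>w t. (q, w, t) \<in> edges G \<and> (e + w \<ge> 0 \<longrightarrow> bad t (e + w) \<and> e + w \<ge> 1)"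
  shows "\<not> P0_wins G s (AEL G 0)"
proof
  assume "P0_wins G s (AEL G 0)"
  then obtain \<sigma> where \<sigma>: "is_strategy G (states0 G) s \<sigma>"
    and win: "outcomes G (states0 G) s \<sigma> \<subseteq> AEL G 0"
    by (auto simp: P0_wins_def)
  \<comment> \<open>The guard \<open>bad q e\<close> makes a spoiling edge exist at all vertices of
    player 1, so that the play can be built before the invariant is proved for it.\<close>
  define spoil where "spoil = (\<lambda>q e ed. ed \<in> edges G \<and> src ed = q \<and>
    (bad q e \<longrightarrow> e + weight ed \<ge> 0 \<longrightarrow> bad (tgt ed) (e + weight ed) \<and> e + weight ed \<ge> 1))"
  have ex_spoil: "\<exists>ed. spoil q e ed" if q: "q \<in> states1 G" for q e
  proof (cases "bad q e")
    case True
    then obtain w t where "(q, w, t) \<in> edges G" "e + w \<ge> 0 \<longrightarrow> bad t (e + w) \<and> e + w \<ge> 1"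
      using bad1 [OF True q] by blast
    then show ?thesis
      by (intro exI [of _ "(q, w, t)"]) (auto simp: spoil_def src_def weight_def tgt_def)
  next
    case False
    then show ?thesis
      using G that unfolding spoil_def weighted_game_def states_def by blast
  qed
  define nxt where "nxt = (\<lambda>\<rho>. if end_state s \<rho> \<in> states0 G then \<sigma> \<rho>
     else SOME ed. spoil (end_state s \<rho>) (EL \<rho>) ed)"
  \<comment> \<open>Both players choose as functions of the prefix, so the play arises by recursion
    on its prefixes.\<close>
  define pre where "pre = rec_nat [] (\<lambda>_ \<rho>. \<rho> @ [nxt \<rho>])"
  have pre_0: "pre 0 = []" and pre_Suc: "pre (Suc n) = pre n @ [nxt (pre n)]" for n
    by (simp_all add: pre_def)
  define \<pi> where "\<pi> = (\<lambda>n. nxt (pre n))"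
  have pp: "play_prefix \<pi> n = pre n" for n
    by (induction n) (auto simp: pre_0 pre_Suc play_prefix_Suc \<pi>_def)
  have nxt_spoil: "spoil (end_state s \<rho>) (EL \<rho>) (nxt \<rho>)"
    if "is_prefix G s \<rho>" "end_state s \<rho> \<in> states G" for \<rho>
  proof (cases "end_state s \<rho> \<in> states0 G")
    case True
    then have *: "\<sigma> \<rho> \<in> edges G" "src (\<sigma> \<rho>) = end_state s \<rho>"
      using \<sigma> that by (auto simp: is_strategy_def)
    then have "(end_state s \<rho>, weight (\<sigma> \<rho>), tgt (\<sigma> \<rho>)) \<in> edges G"
      by (cases "\<sigma> \<rho>") (auto simp: src_def weight_def tgt_def)
    with bad0 [OF _ True this] show ?thesis
      using * True by (auto simp: spoil_def nxt_def)
  next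
    case False
    then have "end_state s \<rho> \<in> states1 G"
      using that by (auto simp: states_def)
    from someI_ex [OF ex_spoil [OF this]] show ?thesis
      using False by (simp add: nxt_def)
  qed
  have pre: "is_prefix G s (pre n) \<and> end_state s (pre n) \<in> states G" for n
  proof (induction n)
    case 0
    then show ?case
      using s by (simp add: pre_0 is_prefix_def)
  next
    case (Suc n)
    then have "spoil (end_state s (pre n)) (EL (pre n)) (nxt (pre n))"
      using nxt_spoil by blast
    then show ?case
      using G Suc
      by (auto simp: spoil_def pre_Suc intro!: is_prefix_snoc)
        (auto simp: weighted_game_def tgt_def)
  qed
  have sp: "spoil (end_state s (pre n)) (EL (pre n)) (\<pi> n)" for n
    using nxt_spoil pre by (simp add: \<pi>_def)
  have play: "is_play G s \<pi>"
    unfolding is_play_def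
  proof (intro conjI allI)
    show "src (\<pi> 0) = s"
      using sp [of 0] by (simp add: spoil_def pre_0)
    fix i show "\<pi> i \<in> edges G"
      using sp [of i] by (simp add: spoil_def)
    show "tgt (\<pi> i) = src (\<pi> (Suc i))"
      using sp [of "Suc i"] by (simp add: spoil_def pre_Suc \<pi>_def)
  qed
  moreover have "\<pi> n = \<sigma> (pre n)" if "end_state s (pre n) \<in> states0 G" for n
    using that by (simp add: \<pi>_def nxt_def)
  ultimately have "\<pi> \<in> outcomes G (states0 G) s \<sigma>"
    by (simp add: outcomes_def pp)
  then have AEL: "\<pi> \<in> AEL G 0"
    using win by blast
  have nonneg: "EL (pre n) \<ge> 0" for n
    using AEL by (cases "n = 0") (auto simp: AEL_def pre_0 pp)
  have "bad (end_state s (pre n)) (EL (pre n)) \<and> (n \<ge> 1 \<longrightarrow> EL (pre n) \<ge> 1)" for n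
  proof (induction n)
    case 0
    then show ?case
      using bad by (simp add: pre_0)
  next
    case (Suc n)
    then show ?case
      using sp [of n] nonneg [of "Suc n"] by (auto simp: spoil_def pre_Suc \<pi>_def)
  qed
  then have "AE_sup \<pi> \<ge> 1"
    by (intro AE_sup_ge_1) (auto simp: pp)
  moreover have "AE_sup \<pi> \<le> 0"
    using AEL by (simp add: AEL_def zero_ereal_def)
  ultimately have "(1::ereal) \<le> 0"
    by (rule order_trans)
  then show False
    by simp
qed


section \<open>The game of a cellular automaton\<close>

definition node :: "nat \<Rightarrow> nat \<Rightarrow> nat" where
  "node t j = 2 ^ j * (2 * t + 1)"

text \<open>A positive number determines its exponent of 2 and its odd part.\<close>

lemma node_inject [simp]: "node t j = node t' j' \<longleftrightarrow> t = t' \<and> j = j'"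
proof (induction j arbitrary: j')
  case 0
  then show ?case
    by (cases j') (auto simp: node_def, presburger+)
next
  case (Suc j)
  show ?case
  proof (cases j')
    case 0
    then show ?thesis
      by (auto simp: node_def) presburger+
  next
    case (Suc i)
    have "node t (Suc k) = 2 * node t k" for t k
      by (simp add: node_def)
    then show ?thesis
      using Suc.IH [of i] Suc by simp
  qed
qed

section \<open>Vertices, the word of the automaton, and the lists of edges\<close>

datatype vertex =
  Ini | Go | Sink | Low nat | Claim nat | Inp nat nat | Tri nat nat nat

text \<open>The first argument of \<open>node\<close> separates the kinds: 0, 1 and 2, then the odd
  numbers from 3 on for \<open>Inp\<close> and the even numbers from 4 on for \<open>Tri\<close>.
  The indices that grow with the input, those of \<open>Low\<close> and \<open>Inp\<close>, go into
  the exponent.\<close>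

fun code :: "vertex \<Rightarrow> nat" where
  "code (Low k) = node 0 k"
| "code Ini = node 1 0"
| "code Go = node 1 1"
| "code Sink = node 1 2"
| "code (Claim a) = node 2 a"
| "code (Inp y j) = node (3 + 2 * y) j"
| "code (Tri a b c) = node (4 + 2 * prod_encode (a, b)) c"

lemma code_inject [simp]: "code s = code t \<longleftrightarrow> s = t"
proof -
  have neq: "3 + 2 * a \<noteq> 4 + 2 * b" "4 + 2 * b \<noteq> 3 + 2 * a" for a b :: nat
    by presburger+
  show ?thesis
    by (cases s; cases t) (simp_all add: neq)
qed

text \<open>The test \<open>D < 3\<close> ensures termination: if \<open>3 \<le> D \<le> c\<close>,
  then even \<open>c - D + 2\<close> is below \<open>c\<close>.\<close>

function ca :: "(nat \<Rightarrow> nat \<Rightarrow> nat \<Rightarrow> nat) \<Rightarrow> (nat \<Rightarrow> nat) \<Rightarrow> nat \<Rightarrow> nat \<Rightarrow> nat" where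
  "ca F u D c = (if c < D \<or> D < 3 then u c
     else F (ca F u D (c - D)) (ca F u D (c - D + 1)) (ca F u D (c - D + 2)))"
  by pat_completeness auto
termination
  by (relation "measure (\<lambda>(F, u, D, c). c)") auto

declare ca.simps [simp del]

lemma ca_init: "c < D \<Longrightarrow> ca F u D c = u c"
  by (subst ca.simps) simp

lemma ca_step: "3 \<le> D \<Longrightarrow> ca F u D (c + D) = F (ca F u D c) (ca F u D (c + 1)) (ca F u D (c + 2))"
  by (subst ca.simps) simp

locale ca_game_data =
  fixes al acc :: "nat list"
    and F :: "nat \<Rightarrow> nat \<Rightarrow> nat \<Rightarrow> nat"
    and blk start :: nat
    and sym :: "bool \<Rightarrow> nat"
    and x :: "bool list"
    and m :: nat
begin

text \<open>Index 0 is the dummy blank, index 1 the left end of the tape with the head on it, and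
  the input begins at index 2.\<close>

definition row0 :: "nat \<Rightarrow> nat" where
  "row0 c = (if c = 0 then blk else if c = 1 then start
     else if c - 2 < length x then sym (x ! (c - 2)) else blk)"

definition cell :: "nat \<Rightarrow> nat" where
  "cell = ca F row0 (2 ^ Suc m)"

definition ys :: "nat list" where
  "ys = [blk, sym False, sym True]"

definition vs0 :: "vertex list" where
  "vs0 = Ini # Go # Sink # map Claim al @ map Low [0..<Suc m] @
     concat (map (\<lambda>j. map (\<lambda>y. Inp y j) ys) [0..<Suc (length x)])"

definition vs1 :: "vertex list" where
  "vs1 = concat (map (\<lambda>a. concat (map (\<lambda>b. map (Tri a b) al) al)) al)"

text \<open>At energy \<open>2 * c + 1\<close>, a weight \<open>2 * d\<close> adds \<open>d\<close>
  to \<open>c\<close>. The weights -1 and -3 into \<open>Sink\<close> test for \<open>c = 0\<close>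
  and \<open>c = 1\<close>, the weight -4 removes the offset 2 of the input, and 0, 2, 4 select one
  of three consecutive indices. The loops at \<open>Claim\<close> provide an outgoing edge for every
  symbol.\<close>

definition const_edges :: "(vertex \<times> int \<times> vertex) list" where
  "const_edges = (Ini, 1, Go) # (Go, 2, Go) # (Sink, 0, Sink) #
     (Claim blk, -1, Sink) # (Claim start, -3, Sink) # (Low 0, -1, Sink) #
     map (\<lambda>y. (Claim y, -4, Inp y 0)) ys @
     map (\<lambda>a. (Go, 0, Claim a)) acc @ map (\<lambda>a. (Claim a, 0, Claim a)) al @
     concat (map (\<lambda>a. concat (map (\<lambda>b. concat (map (\<lambda>c.
       [(Tri a b c, 0, Claim a), (Tri a b c, 2, Claim b), (Tri a b c, 4, Claim c)]) al)) al)) al)"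

text \<open>One binary digit of \<open>c\<close> per edge, since the weight
  \<open>- (2 ^ Suc k)\<close> lowers \<open>c\<close> by \<open>2 ^ k\<close>. Exactly the numbers
  below \<open>2 ^ k\<close> can become 0 between \<open>Low k\<close> and
  \<open>Low 0\<close>.\<close>

definition low_edges :: "(vertex \<times> int \<times> vertex) list" where
  "low_edges = concat (map (\<lambda>k. [(Low (Suc k), 0, Low k), (Low (Suc k), - (2 ^ Suc k), Low k)])
     [0..<m])"

text \<open>The chain lowers \<open>c\<close> by 1 per position, and the exit to \<open>Sink\<close>
  is open only at positions that carry the claimed symbol.\<close>

definition inp_edges :: "(vertex \<times> int \<times> vertex) list" where
  "inp_edges = concat (map (\<lambda>j. (Inp (sym (x ! j)) j, -1, Sink) #
       concat (map (\<lambda>y. [(Inp y j, 0, Inp y j), (Inp y j, -2, Inp y (Suc j))]) ys)) [0..<length x])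
     @ map (\<lambda>y. (Inp y (length x), 0, Inp y (length x))) ys"

text \<open>The edges whose weights or ends mention \<open>m\<close>, set apart because they are
  printed once the counters have reached \<open>m\<close> and \<open>length x\<close>. The weight
  \<open>- (2 ^ (m + 2))\<close> lowers \<open>c\<close> by \<open>2 ^ Suc m\<close>, to the first
  of the three indices that determine the symbol.\<close>

definition tall_edges :: "(vertex \<times> int \<times> vertex) list" where
  "tall_edges = (Inp blk (length x), 0, Low m) # (Claim blk, - (2 ^ (m + 1)), Low m) #
     concat (map (\<lambda>a. concat (map (\<lambda>b. map (\<lambda>c.
       (Claim (F a b c), - (2 ^ (m + 2)), Tri a b c)) al) al)) al)"

definition es :: "(vertex \<times> int \<times> vertex) list" where
  "es = const_edges @ low_edges @ inp_edges @ tall_edges"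

definition input_game :: game_input where
  "input_game = (map code vs0, map code vs1, map (\<lambda>(s, w, t). (code s, w, code t)) es)"

end

section \<open>The game graph\<close>

locale ca_game = ca_game_data +
  assumes F_al: "a \<in> set al \<Longrightarrow> b \<in> set al \<Longrightarrow> c \<in> set al \<Longrightarrow> F a b c \<in> set al"
    and acc_al: "set acc \<subseteq> set al"
    and blk_al: "blk \<in> set al" and start_al: "start \<in> set al" and sym_al: "sym v \<in> set al"
    and distinct: "blk \<noteq> start" "blk \<noteq> sym v" "start \<noteq> sym v" "sym False \<noteq> sym True"
    and m: "1 \<le> m" "length x + 2 \<le> 2 ^ m"
begin

abbreviation "G \<equiv> game_of input_game"

lemma D_ge_3: "3 \<le> (2::nat) ^ Suc m"
proof -
  have "(2::nat) ^ 2 \<le> 2 ^ Suc m"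
    using m(1) by (intro power_increasing) auto
  then show ?thesis by simp
qed

lemma cell_init: "c < 2 ^ Suc m \<Longrightarrow> cell c = row0 c"
  by (simp add: cell_def ca_init)

lemma cell_step: "cell (c + 2 ^ Suc m) = F (cell c) (cell (c + 1)) (cell (c + 2))"
  unfolding cell_def using D_ge_3 by (rule ca_step)

lemma cell_al: "cell c \<in> set al"
proof (induction c rule: less_induct)
  case (less c)
  show ?case
  proof (cases "c < 2 ^ Suc m")
    case True
    then show ?thesis
      using blk_al start_al sym_al by (simp add: cell_init row0_def)
  next
    case False
    then obtain d where d: "c = d + 2 ^ Suc m"
      by (metis add.commute le_Suc_ex not_less)
    then show ?thesis
      unfolding d cell_step by (intro F_al less) (use D_ge_3 in \<open>simp_all add: d\<close>)
  qed
qed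

lemma set_vs0: "s \<in> set vs0 \<longleftrightarrow> (case s of Claim a \<Rightarrow> a \<in> set al | Low k \<Rightarrow> k \<le> m
    | Inp y j \<Rightarrow> y \<in> set ys \<and> j \<le> length x | Tri a b c \<Rightarrow> False | _ \<Rightarrow> True)"
  by (cases s) (auto simp: vs0_def image_iff le_less less_Suc_eq)

lemma set_vs1: "s \<in> set vs1 \<longleftrightarrow>
    (\<exists>a b c. s = Tri a b c \<and> a \<in> set al \<and> b \<in> set al \<and> c \<in> set al)"
  by (auto simp: vs1_def)

text \<open>The edges sorted by their source, as needed for case distinctions on the current
  vertex.\<close>

definition edge :: "vertex \<Rightarrow> int \<Rightarrow> vertex \<Rightarrow> bool" where
  "edge s w t \<longleftrightarrow> (case s of
     Ini \<Rightarrow> w = 1 \<and> t = Go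
   | Go \<Rightarrow> w = 2 \<and> t = Go \<or> w = 0 \<and> (\<exists>a \<in> set acc. t = Claim a)
   | Sink \<Rightarrow> w = 0 \<and> t = Sink
   | Low k \<Rightarrow> k = 0 \<and> w = -1 \<and> t = Sink \<or>
       (\<exists>i < m. k = Suc i \<and> (w = 0 \<or> w = - (2 ^ Suc i)) \<and> t = Low i)
   | Claim a \<Rightarrow> a = blk \<and> w = -1 \<and> t = Sink \<or> a = start \<and> w = -3 \<and> t = Sink \<or>
       a \<in> set ys \<and> w = -4 \<and> t = Inp a 0 \<or> a \<in> set al \<and> w = 0 \<and> t = Claim a \<or>
       a = blk \<and> w = - (2 ^ (m + 1)) \<and> t = Low m \<or>
       (\<exists>b \<in> set al. \<exists>c \<in> set al. \<exists>d \<in> set al.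
          a = F b c d \<and> w = - (2 ^ (m + 2)) \<and> t = Tri b c d)
   | Inp y j \<Rightarrow> j < length x \<and> y = sym (x ! j) \<and> w = -1 \<and> t = Sink \<or>
       j < length x \<and> y \<in> set ys \<and> w = -2 \<and> t = Inp y (Suc j) \<or>
       (j < length x \<or> j = length x) \<and> y \<in> set ys \<and> w = 0 \<and> t = Inp y j \<or>
       y = blk \<and> j = length x \<and> w = 0 \<and> t = Low m
   | Tri a b c \<Rightarrow> a \<in> set al \<and> b \<in> set al \<and> c \<in> set al \<and>
       (w = 0 \<and> t = Claim a \<or> w = 2 \<and> t = Claim b \<or> w = 4 \<and> t = Claim c))"

lemma set_const_edges: "(s, w, t) \<in> set const_edges \<longleftrightarrow>
    s = Ini \<and> w = 1 \<and> t = Go \<or> s = Go \<and> w = 2 \<and> t = Go \<or> s = Sink \<and> w = 0 \<and> t = Sink \<or>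
    s = Claim blk \<and> w = -1 \<and> t = Sink \<or> s = Claim start \<and> w = -3 \<and> t = Sink \<or>
    s = Low 0 \<and> w = -1 \<and> t = Sink \<or> (\<exists>y \<in> set ys. s = Claim y \<and> w = -4 \<and> t = Inp y 0) \<or>
    (\<exists>a \<in> set acc. s = Go \<and> w = 0 \<and> t = Claim a) \<or>
    (\<exists>a \<in> set al. s = Claim a \<and> w = 0 \<and> t = Claim a) \<or>
    (\<exists>a \<in> set al. \<exists>b \<in> set al. \<exists>c \<in> set al. s = Tri a b c \<and>
       (w = 0 \<and> t = Claim a \<or> w = 2 \<and> t = Claim b \<or> w = 4 \<and> t = Claim c))"
  by (cases s) (auto simp: const_edges_def image_iff)

lemma set_low_edges: "(s, w, t) \<in> set low_edges \<longleftrightarrow>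
    (\<exists>i < m. s = Low (Suc i) \<and> (w = 0 \<or> w = - (2 ^ Suc i)) \<and> t = Low i)"
  unfolding low_edges_def by auto

lemma set_inp_edges: "(s, w, t) \<in> set inp_edges \<longleftrightarrow>
    (\<exists>j < length x. s = Inp (sym (x ! j)) j \<and> w = -1 \<and> t = Sink) \<or>
    (\<exists>y \<in> set ys. \<exists>j < length x. s = Inp y j \<and> (w = 0 \<and> t = Inp y j \<or> w = -2 \<and> t = Inp y (Suc j))) \<or>
    (\<exists>y \<in> set ys. s = Inp y (length x) \<and> w = 0 \<and> t = Inp y (length x))"
  by (cases s) (auto simp: inp_edges_def image_iff)

lemma set_tall_edges: "(s, w, t) \<in> set tall_edges \<longleftrightarrow>
    s = Inp blk (length x) \<and> w = 0 \<and> t = Low m \<or> s = Claim blk \<and> w = - (2 ^ (m + 1)) \<and> t = Low m \<or>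
    (\<exists>a \<in> set al. \<exists>b \<in> set al. \<exists>c \<in> set al.
       s = Claim (F a b c) \<and> w = - (2 ^ (m + 2)) \<and> t = Tri a b c)"
  unfolding tall_edges_def by (simp add: image_iff)

lemma set_es: "(s, w, t) \<in> set es \<longleftrightarrow> edge s w t"
proof -
  note set_es_defs = es_def set_append Un_iff set_const_edges set_low_edges set_inp_edges
    set_tall_edges edge_def
  show ?thesis
  proof (cases s)
    case (Claim a)
    show ?thesis
      unfolding Claim set_es_defs by simp
  next
    case (Inp y j)
    show ?thesis
      unfolding Inp set_es_defs by simp metis
  qed (auto simp: set_es_defs)
qed

lemma states0_G: "states0 G = code ` set vs0"
  and states1_G: "states1 G = code ` set vs1"
  and edges_G: "edges G = (\<lambda>(s, w, t). (code s, w, code t)) ` set es"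
  by (simp_all add: input_game_def)

lemma edges_G_iff: "(code s, w, r) \<in> edges G \<longleftrightarrow> (\<exists>t. r = code t \<and> edge s w t)"
  by (auto simp: edges_G set_es [symmetric] image_iff) force

lemma sym_ys: "sym b \<in> set ys"
  by (cases b) (simp_all add: ys_def)

lemma ys_al: "set ys \<subseteq> set al"
  using blk_al sym_al by (simp add: ys_def)

lemma edge_states:
  assumes "edge s w t"
  shows "s \<in> set vs0 \<union> set vs1" "t \<in> set vs0 \<union> set vs1"
proof -
  have "blk \<in> set ys" "blk \<in> set al" "start \<in> set al" "sym b \<in> set ys" for b
    using blk_al start_al sym_ys by (auto simp: ys_def)
  then have "s \<in> set vs0 \<union> set vs1 \<and> t \<in> set vs0 \<union> set vs1"
    using assms ys_al acc_al F_al
    by (cases s) (auto simp: edge_def set_vs0 set_vs1)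
  then show "s \<in> set vs0 \<union> set vs1" "t \<in> set vs0 \<union> set vs1"
    by auto
qed

lemma edge_ex:
  assumes "s \<in> set vs0 \<union> set vs1"
  shows "\<exists>w t. edge s w t"
proof (cases s)
  case (Low k)
  then show ?thesis
    using assms by (cases k) (auto simp: edge_def set_vs0 set_vs1)
next
  case (Inp y j)
  then show ?thesis
    using assms by (intro exI [of _ 0] exI [of _ s]) (auto simp: edge_def set_vs0 set_vs1)
qed (use assms in \<open>auto simp: edge_def set_vs0 set_vs1\<close>)

lemma weighted_game_G: "weighted_game G"
proof -
  have disj: "states0 G \<inter> states1 G = {}"
    by (auto simp: states0_G states1_G set_vs0 set_vs1)
  have out: "\<exists>e \<in> edges G. src e = s" if "s \<in> states G" for s
  proof -
    from that obtain v where v: "s = code v" "v \<in> set vs0 \<union> set vs1"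
      by (auto simp: states_def states0_G states1_G)
    from edge_ex [OF v(2)] obtain w t where "edge v w t"
      by blast
    then have "(s, w, code t) \<in> edges G"
      by (auto simp: v edges_G_iff)
    then show ?thesis
      by (force simp: src_def)
  qed
  define W where "W = nat (\<Sum>ed \<in> edges G. \<bar>weight ed\<bar>)"
  have fin: "finite (edges G)"
    by (simp add: edges_G)
  have "ed \<in> states G \<times> {- int W..int W} \<times> states G" if ed: "ed \<in> edges G" for ed
  proof -
    from ed obtain s w t where st: "ed = (code s, w, code t)" "edge s w t"
      by (auto simp: edges_G set_es)
    have "\<bar>weight ed\<bar> \<le> (\<Sum>ed \<in> edges G. \<bar>weight ed\<bar>)"
      using ed fin by (intro member_le_sum) auto
    moreover have "0 \<le> (\<Sum>ed \<in> edges G. \<bar>weight ed\<bar>)"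
      by (intro sum_nonneg) auto
    ultimately have "\<bar>w\<bar> \<le> int W"
      using st by (simp add: W_def weight_def)
    then have "w \<in> {- int W..int W}"
      by auto
    then show ?thesis
      using edge_states [OF st(2)] by (auto simp: st states_def states0_G states1_G)
  qed
  then have "\<exists>W :: nat. edges G \<subseteq> states G \<times> {- int W..int W} \<times> states G"
    by blast
  then show ?thesis
    using disj out fin unfolding weighted_game_def by (simp add: states0_G states1_G)
qed

section \<open>Player 0 proves true claims\<close>

definition inp_ok :: "nat \<Rightarrow> nat \<Rightarrow> bool" where
  "inp_ok y c \<longleftrightarrow> c < length x \<and> sym (x ! c) = y \<or>
     y = blk \<and> length x \<le> c \<and> c < length x + 2 ^ m"

lemma inp_ok_ys: "inp_ok y c \<Longrightarrow> y \<in> set ys"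
  by (auto simp: inp_ok_def sym_ys) (simp add: ys_def)

text \<open>Here \<open>c\<close> counts from the first input cell. The \<open>Inp\<close> chain
  continues in \<open>Low m\<close> and so reaches \<open>2 ^ m\<close> blanks behind the input;
  they all lie in the first row because \<open>length x + 2 \<le> 2 ^ m\<close>.\<close>

lemma inp_ok_cell: "inp_ok y c \<Longrightarrow> cell (c + 2) = y"
  using m by (auto simp: inp_ok_def cell_init row0_def)

definition vwin :: "vertex \<Rightarrow> int \<Rightarrow> bool" where
  "vwin s e \<longleftrightarrow> (\<exists>k. forced G (code Sink) k (code s) e)"

lemma vwin_Sink: "vwin Sink 0"
  by (auto simp: vwin_def intro: forced_here)

lemma vwin_move: "edge s w t \<and> s \<in> set vs0 \<and> vwin t (e + w) \<and> 0 \<le> e + w \<Longrightarrow> vwin s e"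
  unfolding vwin_def
  by (metis forced_0 edges_G_iff states0_G imageI)

lemma vwin_Tri:
  assumes "Tri a b c \<in> set vs1 \<and> 0 \<le> e \<and>
      vwin (Claim a) e \<and> vwin (Claim b) (e + 2) \<and> vwin (Claim c) (e + 4)"
  shows "vwin (Tri a b c) e"
proof -
  from assms obtain i j k where
    f: "forced G (code Sink) i (code (Claim a)) e"
      "forced G (code Sink) j (code (Claim b)) (e + 2)"
      "forced G (code Sink) k (code (Claim c)) (e + 4)"
    unfolding vwin_def by blast
  \<comment> \<open>The sum serves as a common bound for the three branches, by
    \<open>forced_mono\<close>.\<close>
  have "forced G (code Sink) (Suc (i + j + k)) (code (Tri a b c)) e"
  proof (rule forced_1)
    show "code (Tri a b c) \<in> states1 G"
      using assms by (simp add: states1_G del: code.simps)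
    fix w t assume "(code (Tri a b c), w, t) \<in> edges G"
    then have "w = 0 \<and> t = code (Claim a) \<or> w = 2 \<and> t = code (Claim b) \<or>
        w = 4 \<and> t = code (Claim c)"
      by (auto simp: edges_G_iff edge_def simp del: code.simps)
    then show "0 \<le> e + w \<and> forced G (code Sink) (i + j + k) t (e + w)"
      using f assms by (auto intro: forced_mono [rotated] simp del: code.simps)
  qed
  then show ?thesis
    by (auto simp: vwin_def simp del: code.simps)
qed

text \<open>Player 0 reads the binary digits of \<open>c\<close> from the top and takes the edge of
  negative weight exactly when \<open>2 ^ k \<le> c\<close>.\<close>

lemma vwin_Low: "k \<le> m \<Longrightarrow> c < 2 ^ k \<Longrightarrow> vwin (Low k) (2 * int c + 1)"
proof (induction k arbitrary: c)
  case 0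
  then show ?case
    by (intro vwin_move [of _ "-1" Sink]) (auto simp: edge_def set_vs0 vwin_Sink)
next
  case (Suc k)
  show ?case
  proof (cases "c < 2 ^ k")
    case True
    then show ?thesis
      using Suc by (intro vwin_move [of _ 0 "Low k"]) (auto simp: edge_def set_vs0)
  next
    case False
    then obtain d where d: "c = 2 ^ k + d"
      by (metis le_Suc_ex not_less)
    then show ?thesis
      using Suc by (intro vwin_move [of _ "- (2 ^ Suc k)" "Low k"]) (auto simp: edge_def set_vs0)
  qed
qed

text \<open>Player 0 walks along the chain until the energy is 1 and leaves for \<open>Sink\<close>.
  If she arrives at the end of the input, then \<open>y\<close> is the blank and
  \<open>Low m\<close> takes over.\<close>

lemma vwin_Inp:
  assumes "inp_ok y (c + j)" "j \<le> length x"
  shows "vwin (Inp y j) (2 * int c + 1)"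
  using assms
proof (induction c arbitrary: j)
  case 0
  have y: "y \<in> set ys"
    using 0 by (intro inp_ok_ys)
  show ?case
  proof (cases "j < length x")
    case True
    then show ?thesis
      using 0 y by (intro vwin_move [of _ "-1" Sink])
        (auto simp: edge_def set_vs0 vwin_Sink inp_ok_def)
  next
    case False
    then show ?thesis
      using 0 y vwin_Low [of m 0] by (intro vwin_move [of _ 0 "Low m"])
        (auto simp: edge_def set_vs0 inp_ok_def)
  qed
next
  case (Suc c)
  have y: "y \<in> set ys"
    using Suc.prems by (intro inp_ok_ys)
  show ?case
  proof (cases "j < length x")
    case True
    then show ?thesis
      using Suc.IH [of "Suc j"] Suc.prems y by (intro vwin_move [of _ "-2" "Inp y (Suc j)"])
        (auto simp: edge_def set_vs0 add.commute)
  next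
    case False
    then show ?thesis
      using Suc y vwin_Low [of m "Suc c"] by (intro vwin_move [of _ 0 "Low m"])
        (auto simp: edge_def set_vs0 inp_ok_def)
  qed
qed

text \<open>Claims about the first row are verified directly; a claim about a later index reduces to
  three smaller indices by \<open>cell_step\<close>.\<close>

lemma vwin_Claim: "vwin (Claim (cell c)) (2 * int c + 1)"
proof (induction c rule: less_induct)
  case (less c)
  have V: "Claim (cell c) \<in> set vs0"
    using cell_al by (simp add: set_vs0)
  \<comment> \<open>Cases 3 and 4 together cover the first row from index 2 on: the input and the
    near blanks through the \<open>Inp\<close> chain, the far blanks through \<open>Low m\<close>.
    On some blanks both apply.\<close>
  consider "c = 0" | "c = 1" | d where "c = d + 2" "c < 2 ^ Suc m" "inp_ok (cell c) d"
    | d where "c = 2 ^ m + d" "d < 2 ^ m" "cell c = blk"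
    | d where "c = d + 2 ^ Suc m"
  proof (cases "c < 2 ^ Suc m")
    case False
    then obtain d where "c = d + 2 ^ Suc m"
      by (metis add.commute le_Suc_ex not_less)
    then show ?thesis
      using that by blast
  next
    case True
    show ?thesis
    proof (cases "c < 2")
      case True
      then show ?thesis
        using that(1,2) by linarith
    next
      case False
      then obtain d where d: "c = d + 2"
        by (metis add.commute le_Suc_ex not_less)
      show ?thesis
      proof (cases "d < length x + 2 ^ m")
        case True
        then have "inp_ok (cell c) d"
          using d \<open>c < 2 ^ Suc m\<close> by (auto simp: inp_ok_def cell_init row0_def)
        then show ?thesis
          using d \<open>c < 2 ^ Suc m\<close> that(3) by blast
      next
        case False
        then show ?thesis
          using d \<open>c < 2 ^ Suc m\<close> that(4) [of "c - 2 ^ m"]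
          by (auto simp: cell_init row0_def)
      qed
    qed
  qed
  then show ?case
  proof cases
    case 1
    then have "cell c = blk"
      by (simp add: cell_init row0_def)
    then show ?thesis
      using V 1 by (intro vwin_move [of _ "-1" Sink]) (auto simp: edge_def vwin_Sink)
  next
    case 2
    then have "cell c = start"
      using D_ge_3 by (simp add: cell_init row0_def)
    then show ?thesis
      using V 2 by (intro vwin_move [of _ "-3" Sink]) (auto simp: edge_def vwin_Sink)
  next
    case (3 d)
    then have "cell c \<in> set ys"
      by (intro inp_ok_ys)
    moreover have "vwin (Inp (cell c) 0) (2 * int d + 1)"
      using 3 by (intro vwin_Inp) auto
    ultimately show ?thesis
      using V 3 by (intro vwin_move [of _ "-4" "Inp (cell c) 0"]) (auto simp: edge_def add.commute)
  next
    case (4 d)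
    then show ?thesis
      using V vwin_Low [of m d]
      by (intro vwin_move [of _ "- (2 ^ (m + 1))" "Low m"]) (auto simp: edge_def)
  next
    case (5 d)
    let ?t = "Tri (cell d) (cell (d + 1)) (cell (d + 2))"
    have "vwin (Claim (cell d)) (2 * int d + 1)" "vwin (Claim (cell (d + 1))) (2 * int (d + 1) + 1)"
      "vwin (Claim (cell (d + 2))) (2 * int (d + 2) + 1)"
      using D_ge_3 unfolding 5 by (intro less; simp add: 5)+
    then have "vwin ?t (2 * int d + 1)"
      using cell_al by (intro vwin_Tri) (auto simp: set_vs1 algebra_simps)
    moreover have "edge (Claim (cell c)) (- (2 ^ (m + 2))) ?t"
      using cell_al by (auto simp: 5 cell_step [simplified] edge_def)
    ultimately show ?thesis
      using V by (intro vwin_move [of _ "- (2 ^ (m + 2))" ?t]) (auto simp: 5)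
  qed
qed

text \<open>Each turn of the loop at \<open>Go\<close> raises \<open>c\<close> by 1; player 0 leaves
  it at the index of an accepting symbol.\<close>

lemma vwin_Ini:
  assumes "cell c \<in> set acc"
  shows "vwin Ini 0"
proof -
  have Go: "vwin Go (2 * int i + 1)" if "i \<le> c" for i
    using that
  proof (induction i rule: inc_induct)
    case base
    show ?case
      using assms vwin_Claim [of c]
      by (intro vwin_move [of _ 0 "Claim (cell c)"]) (auto simp: edge_def set_vs0)
  next
    case (step i)
    then show ?case
      by (intro vwin_move [of _ 2 Go]) (auto simp: edge_def set_vs0)
  qed
  show ?thesis
    using Go [of 0] by (intro vwin_move [of _ 1 Go]) (auto simp: edge_def set_vs0)
qed

section \<open>Player 1 refutes false claims\<close>

fun holds :: "vertex \<Rightarrow> nat \<Rightarrow> bool" where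
  "holds Go c \<longleftrightarrow> (\<exists>d \<ge> c. cell d \<in> set acc)"
| "holds (Low k) c \<longleftrightarrow> c < 2 ^ k"
| "holds (Claim a) c \<longleftrightarrow> cell c = a"
| "holds (Inp y j) c \<longleftrightarrow> inp_ok y (c + j)"
| "holds (Tri a b d) c \<longleftrightarrow> cell c = a \<and> cell (c + 1) = b \<and> cell (c + 2) = d"
| "holds _ c \<longleftrightarrow> False"

text \<open>The invariant for \<open>spoiled_not_P0_wins\<close>: what the vertex asserts about
  \<open>c\<close> is false. At \<open>Sink\<close> it is too late for energy 0, since the energy is
  positive and no longer changes.\<close>

definition lost :: "vertex \<Rightarrow> int \<Rightarrow> bool" where
  "lost s e \<longleftrightarrow> e \<ge> 0 \<and> (case s of
     Ini \<Rightarrow> e = 0 \<and> (\<forall>c. cell c \<notin> set acc)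
   | Sink \<Rightarrow> even e \<and> e > 0
   | _ \<Rightarrow> \<exists>c. e = 2 * int c + 1 \<and> \<not> holds s c)"

lemma lost_ge_1: "lost s e \<Longrightarrow> s \<noteq> Ini \<Longrightarrow> e \<ge> 1"
  by (auto simp: lost_def split: vertex.splits)

lemma lostE:
  assumes "lost s e" "s \<noteq> Ini" "s \<noteq> Sink"
  obtains c where "e = 2 * int c + 1" "\<not> holds s c"
  using assms by (auto simp: lost_def split: vertex.splits)

lemma lostI: "s \<noteq> Ini \<Longrightarrow> s \<noteq> Sink \<Longrightarrow> \<not> holds s c \<Longrightarrow> lost s (2 * int c + 1)"
  by (auto simp: lost_def split: vertex.splits)

text \<open>An odd energy that stays nonnegative after losing \<open>2 * d\<close> forces
  \<open>d \<le> c\<close>, so that the new energy again has the form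
  \<open>2 * c' + 1\<close>.\<close>

lemma lost_down:
  assumes "0 \<le> 2 * int c + 1 - 2 * int d" and "\<And>c'. c = c' + d \<Longrightarrow> \<not> holds t c'"
    and "t \<noteq> Ini" "t \<noteq> Sink"
  shows "lost t (2 * int c + 1 - 2 * int d)"
proof -
  from assms(1) have "d \<le> c"
    by presburger
  then obtain c' where "c = c' + d"
    by (metis add.commute le_Suc_ex)
  then show ?thesis
    using assms lostI [of t c'] by simp
qed

text \<open>Player 0 can only pass from a false assertion to a false one. The exits to
  \<open>Sink\<close> have odd weights, and they lead to energy 0 only if the assertion was
  true.\<close>

lemma lost_move:
  assumes "lost s e" "edge s w t" "s \<in> set vs0" "0 \<le> e + w"
  shows "lost t (e + w)"
proof (cases "s = Ini \<or> s = Sink")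
  case True
  then show ?thesis
    using assms lostI [of Go 0] by (auto simp: lost_def edge_def)
next
  case False
  with assms obtain c where c: "e = 2 * int c + 1" "\<not> holds s c"
    by (metis lostE)
  show ?thesis
  proof (cases s)
    case Go
    then have "lost (Claim a) e" if "a \<in> set acc" for a
      using that c lostI [of "Claim a" c] by auto
    then show ?thesis
      using assms(2) c Go lostI [of Go "Suc c"] by (auto simp: edge_def)
  next
    case (Low k)
    show ?thesis
    proof (cases k)
      case 0
      then show ?thesis
        using assms(2) c Low by (auto simp: edge_def lost_def)
    next
      case (Suc i)
      then have "t = Low i" "w = 0 \<or> w = - (2 ^ Suc i)"
        using assms(2) Low by (auto simp: edge_def)
      then show ?thesis
        using c Low Suc lostI [of "Low i" c] lost_down [of c "2 ^ i" "Low i"] assms(4)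
        by auto
    qed
  next
    case (Claim a)
    with assms(2) consider "w = 0" "t = Claim a" | "a = blk" "w = -1" "t = Sink"
      | "a = start" "w = -3" "t = Sink" | "w = -4" "t = Inp a 0"
      | "a = blk" "w = - (2 ^ (m + 1))" "t = Low m"
      | b1 b2 b3 where "w = - (2 ^ (m + 2))" "a = F b1 b2 b3" "t = Tri b1 b2 b3"
      by (auto simp: edge_def)
    then show ?thesis
    proof cases
      case 1
      then show ?thesis
        using c Claim lostI [of "Claim a" c] by auto
    next
      case 2
      moreover have "cell 0 = blk"
        by (simp add: cell_init row0_def)
      ultimately have "c \<noteq> 0"
        using c Claim by (intro notI) auto
      then show ?thesis
        using c \<open>w = -1\<close> \<open>t = Sink\<close> by (auto simp: lost_def)
    next
      case 3
      moreover have "cell 1 = start"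
        using D_ge_3 by (simp add: cell_init row0_def)
      ultimately have "c \<noteq> 1"
        using c Claim by (intro notI) auto
      then show ?thesis
        using c assms(4) \<open>w = -3\<close> \<open>t = Sink\<close> by (auto simp: lost_def)
    next
      case 4
      then show ?thesis
        using c Claim lost_down [of c 2 "Inp a 0"] assms(4) inp_ok_cell by auto
    next
      case 5
      \<comment> \<open>From index \<open>2 ^ m\<close> on the first row is blank, because
        \<open>length x + 2 \<le> 2 ^ m\<close>.\<close>
      have "cell (d + 2 ^ m) = blk" if "d < 2 ^ m" for d
        using that m by (auto simp: cell_init row0_def)
      then show ?thesis
        using 5 c Claim lost_down [of c "2 ^ m" "Low m"] assms(4) by auto
    next
      case 6
      then show ?thesis
        using c Claim lost_down [of c "2 ^ Suc m" "Tri b1 b2 b3"] assms(4) cell_step by auto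
    qed
  next
    case (Inp y j)
    with assms(2) consider "j < length x" "y = sym (x ! j)" "w = -1" "t = Sink"
      | "w = -2" "t = Inp y (Suc j)" | "w = 0" "t = Inp y j"
      | "y = blk" "j = length x" "w = 0" "t = Low m"
      by (auto simp: edge_def)
    then show ?thesis
    proof cases
      case 1
      then have "c \<noteq> 0"
        using c Inp by (intro notI) (auto simp: inp_ok_def)
      then show ?thesis
        using c \<open>w = -1\<close> \<open>t = Sink\<close> by (auto simp: lost_def)
    next
      case 2
      then show ?thesis
        using c Inp assms(4) lostI [of "Inp y (Suc j)" "c - 1"] by (cases c) (auto simp: add.commute)
    next
      case 3
      then show ?thesis
        using c Inp lostI [of "Inp y j" c] by auto
    next
      case 4
      then show ?thesis
        using c Inp lostI [of "Low m" c] by (auto simp: inp_ok_def)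
    qed
  qed (use False assms in \<open>auto simp: set_vs0\<close>)
qed

text \<open>One component of a false triple is wrong; player 1 moves to that claim, and the weight
  of the edge adjusts the energy to its index.\<close>

lemma lost_Tri:
  assumes "lost (Tri a b d) e" "Tri a b d \<in> set vs1"
  shows "\<exists>w t. edge (Tri a b d) w t \<and> lost t (e + w)"
proof -
  from assms obtain c where c: "e = 2 * int c + 1" "\<not> holds (Tri a b d) c"
    by (metis lostE vertex.distinct)
  have al: "a \<in> set al" "b \<in> set al" "d \<in> set al"
    using assms by (auto simp: set_vs1)
  from c(2) consider "cell c \<noteq> a" | "cell (c + 1) \<noteq> b" | "cell (c + 2) \<noteq> d"
    by auto
  then show ?thesis
  proof cases
    case 1
    then show ?thesis
      using c al lostI [of "Claim a" c]
      by (intro exI [of _ 0] exI [of _ "Claim a"]) (auto simp: edge_def)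
  next
    case 2
    then have "lost (Claim b) (e + 2)"
      using c lostI [of "Claim b" "c + 1"] by (simp add: algebra_simps)
    then show ?thesis
      using al by (auto simp: edge_def)
  next
    case 3
    then have "lost (Claim d) (e + 4)"
      using c lostI [of "Claim d" "c + 2"] by (simp add: algebra_simps)
    then show ?thesis
      using al by (auto simp: edge_def)
  qed
qed

lemma Ini_state: "code Ini \<in> states G"
  by (auto simp: states_def states0_G set_vs0 intro!: imageI simp del: code.simps)

lemma edge_not_Ini: "edge s w t \<Longrightarrow> t \<noteq> Ini"
  by (auto simp: edge_def split: vertex.splits)

lemma P0_wins_iff: "P0_wins G (code Ini) (AEL G 0) \<longleftrightarrow> (\<exists>c. cell c \<in> set acc)"
proof
  assume "\<exists>c. cell c \<in> set acc"
  then obtain N where N: "forced G (code Sink) N (code Ini) 0"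
    using vwin_Ini by (auto simp: vwin_def)
  show "P0_wins G (code Ini) (AEL G 0)"
    using weighted_game_G Ini_state _ _ N
  proof (rule forced_P0_wins)
    show "code Sink \<in> states0 G"
      by (auto simp: states0_G set_vs0 intro!: imageI simp del: code.simps)
    show "(code Sink, 0, code Sink) \<in> edges G"
      unfolding edges_G_iff by (auto simp: edge_def)
  qed
next
  assume wins: "P0_wins G (code Ini) (AEL G 0)"
  show "\<exists>c. cell c \<in> set acc"
  proof (rule ccontr)
    assume no: "\<not> ?thesis"
    define bad where "bad = (\<lambda>q e. \<exists>s. q = code s \<and> lost s e)"
    have "\<not> P0_wins G (code Ini) (AEL G 0)"
    proof (rule spoiled_not_P0_wins [OF weighted_game_G Ini_state, where bad = bad])
      show "bad (code Ini) 0"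
        using no by (auto simp: bad_def lost_def simp del: code.simps)
    next
      fix q w r e
      assume "bad q e" "q \<in> states0 G" "(q, w, r) \<in> edges G" "0 \<le> e + w"
      then obtain s t where st: "q = code s" "lost s e" "s \<in> set vs0" "r = code t" "edge s w t"
        by (auto simp: bad_def states0_G edges_G_iff simp del: code.simps)
      then have "lost t (e + w)"
        using lost_move \<open>0 \<le> e + w\<close> by blast
      moreover have "e + w \<ge> 1"
        using calculation edge_not_Ini lost_ge_1 st by blast
      ultimately show "bad r (e + w) \<and> 1 \<le> e + w"
        using st by (auto simp: bad_def simp del: code.simps)
    next
      fix q e
      assume "bad q e" "q \<in> states1 G"
      then obtain a b c where t: "q = code (Tri a b c)" "lost (Tri a b c) e" "Tri a b c \<in> set vs1"
        by (auto simp: bad_def states1_G set_vs1 simp del: code.simps)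
      then obtain w t where "edge (Tri a b c) w t" "lost t (e + w)"
        using lost_Tri by blast
      moreover have "e + w \<ge> 1"
        using calculation edge_not_Ini lost_ge_1 by blast
      ultimately show "\<exists>w t. (q, w, t) \<in> edges G \<and> (0 \<le> e + w \<longrightarrow> bad t (e + w) \<and> 1 \<le> e + w)"
        using t by (auto simp: bad_def edges_G_iff simp del: code.simps)
    qed
    then show False
      using wins by blast
  qed
qed

end


section \<open>Space-bounded machines as cellular automata\<close>

text \<open>The flag \<open>z\<close> marks the left end of the tape, \<open>h\<close> is 0 away
  from the head and the successor of the state under it, and \<open>a\<close> is the tape
  symbol.\<close>

definition tsym :: "nat \<Rightarrow> nat \<Rightarrow> nat \<Rightarrow> nat" where
  "tsym z h a = prod_encode (z, prod_encode (h, a))"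

definition tsym_z :: "nat \<Rightarrow> nat" where
  "tsym_z s = fst (prod_decode s)"

definition tsym_h :: "nat \<Rightarrow> nat" where
  "tsym_h s = fst (prod_decode (snd (prod_decode s)))"

definition tsym_a :: "nat \<Rightarrow> nat" where
  "tsym_a s = snd (prod_decode (snd (prod_decode s)))"

lemma tsym_sel [simp]: "tsym_z (tsym z h a) = z" "tsym_h (tsym z h a) = h" "tsym_a (tsym z h a) = a"
  by (simp_all add: tsym_def tsym_z_def tsym_h_def tsym_a_def)

lemma tsym_inject [simp]: "tsym z h a = tsym z' h' a' \<longleftrightarrow> z = z' \<and> h = h' \<and> a = a'"
  by (metis tsym_sel)

lemma tsym_collapse: "tsym (tsym_z s) (tsym_h s) (tsym_a s) = s"
  by (simp add: tsym_def tsym_z_def tsym_h_def tsym_a_def)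

definition act1 :: "tm \<Rightarrow> nat \<Rightarrow> nat \<Rightarrow> nat \<times> nat \<times> dir" where
  "act1 M q a = (case trans M q [a] of (q', acts) \<Rightarrow> (q', hd acts))"

definition leaves :: "tm \<Rightarrow> dir \<Rightarrow> nat \<Rightarrow> bool" where
  "leaves M d s \<longleftrightarrow> tsym_h s > 0 \<and> tsym_h s - 1 \<noteq> accept M \<and> tsym_h s - 1 \<noteq> reject M \<and>
     snd (snd (act1 M (tsym_h s - 1) (tsym_a s))) = d"

definition new_state :: "tm \<Rightarrow> nat \<Rightarrow> nat" where
  "new_state M s = fst (act1 M (tsym_h s - 1) (tsym_a s))"

text \<open>At the ends of a row, the neighbours in the word are not neighbours on the tape. The
  flag \<open>z\<close> screens them off: a flagged cell ignores its left neighbour, and a flagged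
  right neighbour is ignored. A move to the left from a flagged cell leaves the head there.\<close>

definition local_rule :: "tm \<Rightarrow> nat \<Rightarrow> nat \<Rightarrow> nat \<Rightarrow> nat" where
  "local_rule M l s r =
     (if tsym_h s > 0 then
        (if tsym_h s - 1 = accept M \<or> tsym_h s - 1 = reject M then s
         else tsym (tsym_z s)
           (if leaves M Stay s \<or> leaves M Lft s \<and> tsym_z s = 1 then Suc (new_state M s) else 0)
           (fst (snd (act1 M (tsym_h s - 1) (tsym_a s)))))
      else tsym (tsym_z s)
        (if tsym_z s = 0 \<and> leaves M Rgt l then Suc (new_state M l)
         else if tsym_z r = 0 \<and> leaves M Lft r then Suc (new_state M r) else 0)
        (tsym_a s))"

definition cell_sym :: "config \<Rightarrow> nat \<Rightarrow> nat" where
  "cell_sym cfg i = tsym (if i = 0 then 1 else 0)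
     (if i = snd (hd (snd cfg)) then Suc (fst cfg) else 0) (fst (hd (snd cfg)) i)"

definition tsyms :: "tm \<Rightarrow> nat list" where
  "tsyms M = concat (map (\<lambda>z. concat (map (\<lambda>h. map (tsym z h) [0..<num_syms M])
     [0..<Suc (num_states M)])) [0, 1])"

definition acc_syms :: "tm \<Rightarrow> nat list" where
  "acc_syms M = concat (map (\<lambda>z. map (tsym z (Suc (accept M))) [0..<num_syms M]) [0, 1])"

definition blank_sym :: nat where
  "blank_sym = tsym 0 0 0"

definition start_sym :: nat where
  "start_sym = tsym 1 1 1"

definition bit_sym :: "bool \<Rightarrow> nat" where
  "bit_sym b = tsym 0 0 (if b then 3 else 2)"

lemma set_tsyms: "s \<in> set (tsyms M) \<longleftrightarrow>
    tsym_z s < 2 \<and> tsym_h s \<le> num_states M \<and> tsym_a s < num_syms M"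
proof
  assume "tsym_z s < 2 \<and> tsym_h s \<le> num_states M \<and> tsym_a s < num_syms M"
  then have "tsym (tsym_z s) (tsym_h s) (tsym_a s) \<in> set (tsyms M)"
    unfolding tsyms_def by (auto simp: less_2_cases_iff le_less image_iff)
  then show "s \<in> set (tsyms M)"
    by (simp only: tsym_collapse)
qed (auto simp: tsyms_def)

lemma act1_bounds:
  assumes "turing_machine M" "num_tapes M = 1" "q < num_states M" "a < num_syms M"
  shows "fst (act1 M q a) < num_states M" "fst (snd (act1 M q a)) < num_syms M"
    "trans M q [a] = (fst (act1 M q a), [snd (act1 M q a)])"
proof -
  have "case trans M q [a] of (q', acts) \<Rightarrow>
      q' < num_states M \<and> length acts = num_tapes M \<and> (\<forall>(a, d) \<in> set acts. a < num_syms M)"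
  proof -
    have "\<forall>q < num_states M. \<forall>as. length as = num_tapes M \<and> (\<forall>a \<in> set as. a < num_syms M) \<longrightarrow>
        (case trans M q as of (q', acts) \<Rightarrow>
           q' < num_states M \<and> length acts = num_tapes M \<and> (\<forall>(a, d) \<in> set acts. a < num_syms M))"
      using assms(1) unfolding turing_machine_def by (elim conjE)
    from this [rule_format, OF assms(3), of "[a]"] show ?thesis
      using assms(2,4) by simp
  qed
  then show "fst (act1 M q a) < num_states M" "fst (snd (act1 M q a)) < num_syms M"
    "trans M q [a] = (fst (act1 M q a), [snd (act1 M q a)])"
    using assms(2) by (auto simp: act1_def length_Suc_conv split: prod.splits)
qed

lemma local_rule_tsyms:
  assumes M: "turing_machine M" "num_tapes M = 1"
    and "l \<in> set (tsyms M)" "s \<in> set (tsyms M)" "r \<in> set (tsyms M)"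
  shows "local_rule M l s r \<in> set (tsyms M)"
proof -
  have new: "Suc (new_state M t) \<le> num_states M" if "leaves M d t" "t \<in> set (tsyms M)" for t d
    unfolding new_state_def Suc_le_eq
    using that by (intro act1_bounds [OF M]) (auto simp: set_tsyms leaves_def)
  have "fst (snd (act1 M (tsym_h s - 1) (tsym_a s))) < num_syms M" if "tsym_h s > 0"
    using that assms by (intro act1_bounds [OF M]) (auto simp: set_tsyms)
  then show ?thesis
    using assms new by (auto simp: local_rule_def set_tsyms)
qed

text \<open>The hypotheses on \<open>l\<close> and \<open>r\<close> allow for the ends of a row: the
  left neighbour of cell 0 is arbitrary, and the right neighbour may be a flagged symbol as long as
  the head is not on cell \<open>i + 1\<close>.\<close>

lemma cell_sym_step:
  assumes M: "turing_machine M" "num_tapes M = 1"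
    and cfg: "cfg = (q, [(c, p)])" "q < num_states M" "\<And>i. c i < num_syms M"
    and l: "i > 0 \<Longrightarrow> l = cell_sym cfg (i - 1)"
    and r: "r = cell_sym cfg (i + 1) \<or> tsym_z r = 1 \<and> p \<noteq> i + 1"
  shows "cell_sym (step M cfg) i = local_rule M l (cell_sym cfg i) r"
proof (cases "halted M cfg")
  case True
  then have no: "\<not> leaves M d (cell_sym cfg j)" for d j
    using cfg(1) by (auto simp: leaves_def cell_sym_def halted_def)
  let ?s = "cell_sym cfg i"
  have z: "tsym_z ?s = 0 \<longleftrightarrow> i > 0"
    by (simp add: cell_sym_def)
  have no_arrival: "\<not> (tsym_z ?s = 0 \<and> leaves M Rgt l)" "\<not> (tsym_z r = 0 \<and> leaves M Lft r)"
    using l r no z by auto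
  have "local_rule M l ?s r = ?s"
  proof (cases "tsym_h ?s = 0")
    case True
    then have "local_rule M l ?s r = tsym (tsym_z ?s) (tsym_h ?s) (tsym_a ?s)"
      unfolding local_rule_def using no_arrival by (simp only: if_False simp_thms less_irrefl)
    then show ?thesis
      by (simp only: tsym_collapse)
  next
    case h: False
    then have "tsym_h ?s - 1 = accept M \<or> tsym_h ?s - 1 = reject M"
      using True cfg(1) by (auto simp: cell_sym_def halted_def)
    then show ?thesis
      using h by (simp add: local_rule_def)
  qed
  then show ?thesis
    using True by (simp add: step_def)
next
  case False
  obtain q' a' d where act: "act1 M q (c p) = (q', a', d)"
    by (cases "act1 M q (c p)") auto
  have trans: "trans M q [c p] = (q', [(a', d)])"
    using act1_bounds(3) [OF M cfg(2) cfg(3)] act by simp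
  have step: "step M cfg = (q', [(c(p := a'), move d p)])"
    using False by (simp add: step_def cfg trans)
  have leaves: "leaves M e (cell_sym cfg j) \<longleftrightarrow> j = p \<and> e = d" for e j
    using False act by (auto simp: leaves_def cell_sym_def cfg halted_def)
  have new: "new_state M (cell_sym cfg p) = q'"
    using act by (simp add: new_state_def cell_sym_def cfg)
  show ?thesis
  proof (cases "i = p")
    case True
    have "tsym_h (cell_sym cfg i) = Suc q" "tsym_a (cell_sym cfg i) = c p"
      "tsym_z (cell_sym cfg i) = (if p = 0 then 1 else 0)"
      by (simp_all add: cell_sym_def cfg True)
    then have "local_rule M l (cell_sym cfg i) r = tsym (if p = 0 then 1 else 0)
        (if d = Stay \<or> d = Lft \<and> p = 0 then Suc q' else 0) a'"
      using False act new leaves [of _ p] unfolding local_rule_def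
      by (cases d; cases "p = 0") (simp_all add: True halted_def cfg(1))
    then show ?thesis
      by (cases d) (auto simp: True step cell_sym_def)
  next
    case i: False
    have s: "tsym_h (cell_sym cfg i) = 0" "tsym_a (cell_sym cfg i) = c i"
      "tsym_z (cell_sym cfg i) = (if i = 0 then 1 else 0)"
      using i by (simp_all add: cell_sym_def cfg)
    have L: "(i > 0 \<and> leaves M Rgt l) \<longleftrightarrow> i > 0 \<and> p = i - 1 \<and> d = Rgt"
      using l leaves by auto
    have R: "(tsym_z r = 0 \<and> leaves M Lft r) \<longleftrightarrow> p = i + 1 \<and> d = Lft"
    proof -
      have "tsym_z (cell_sym cfg (i + 1)) = 0"
        by (simp add: cell_sym_def)
      then show ?thesis
        using r leaves by auto
    qed
    have "local_rule M l (cell_sym cfg i) r = tsym (if i = 0 then 1 else 0)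
       (if i > 0 \<and> p = i - 1 \<and> d = Rgt then Suc q'
        else if p = i + 1 \<and> d = Lft then Suc q' else 0) (c i)"
      using L R l r new unfolding local_rule_def s by auto
    then show ?thesis
      using i by (cases d) (auto simp: step cell_sym_def)
  qed
qed

section \<open>Runs of machines with a single tape\<close>

lemma contents_less_4: "contents x i < 4"
  by (simp add: contents_def)

lemma run_single:
  assumes M: "turing_machine M" "num_tapes M = 1"
  shows "\<exists>q c p. run M x k = (q, [(c, p)]) \<and> q < num_states M \<and> (\<forall>i. c i < num_syms M)"
proof (induction k)
  case 0
  have "contents x i < num_syms M" for i
    using contents_less_4 [of x i] M by (simp add: turing_machine_def)
  then show ?case
    using M by (simp add: run_def init_def turing_machine_def)
next
  case (Suc k)
  then obtain q c p where cfg: "run M x k = (q, [(c, p)])" "q < num_states M" "\<And>i. c i < num_syms M"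
    by blast
  have *: "run M x (Suc k) = step M (q, [(c, p)])"
    using cfg by (simp add: run_def)
  obtain q' a' d where act: "act1 M q (c p) = (q', a', d)"
    by (cases "act1 M q (c p)") auto
  show ?case
    using act1_bounds [OF M cfg(2) cfg(3), of p] act cfg
    by (auto simp: * step_def)
qed

lemma run_halted_stable: "k \<le> k' \<Longrightarrow> halted M (run M x k) \<Longrightarrow> run M x k' = run M x k"
proof (induction k' rule: nat_induct_at_least)
  case (Suc k')
  then show ?case
    by (simp add: run_def) (simp add: step_def)
qed simp_all

text \<open>Halted configurations do not change, so no run meets both the accepting and the
  rejecting state.\<close>

lemma decides_iff_accepts:
  assumes "turing_machine M" "decides M L"
  shows "x \<in> L \<longleftrightarrow> (\<exists>k. fst (run M x k) = accept M)"
proof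
  assume "\<exists>k. fst (run M x k) = accept M"
  then obtain k where k: "fst (run M x k) = accept M"
    by blast
  obtain j where j: "fst (run M x j) = (if x \<in> L then accept M else reject M)"
    using assms(2) by (auto simp: decides_def)
  have "halted M (run M x k)" "halted M (run M x j)"
    using j k by (auto simp: halted_def)
  then have "run M x k = run M x j"
    by (metis nat_le_linear run_halted_stable)
  then show "x \<in> L"
    using j k assms(1) by (auto simp: turing_machine_def split: if_splits)
next
  assume "x \<in> L"
  then show "\<exists>k. fst (run M x k) = accept M"
    using assms(2) unfolding decides_def by (metis (full_types))
qed

section \<open>The word lists the configurations of the run\<close>

locale tm_game =
  fixes M :: tm and S :: "nat \<Rightarrow> nat" and x :: "bool list" and m :: nat
  assumes M: "turing_machine M" "num_tapes M = 1"
    and space: "space_bounded M S"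
    and m_bounds: "S (length x) \<le> 2 ^ m" "1 \<le> m" "length x + 2 \<le> 2 ^ m"
begin

sublocale ca_game "tsyms M" "acc_syms M" "local_rule M" blank_sym start_sym bit_sym x m
proof
  fix v
  show "bit_sym v \<in> set (tsyms M)"
    using M by (simp add: set_tsyms bit_sym_def turing_machine_def)
next
  fix a b c
  assume "a \<in> set (tsyms M)" "b \<in> set (tsyms M)" "c \<in> set (tsyms M)"
  then show "local_rule M a b c \<in> set (tsyms M)"
    by (rule local_rule_tsyms [OF M])
qed (use M m_bounds in \<open>auto simp: set_tsyms acc_syms_def bit_sym_def
      blank_sym_def start_sym_def turing_machine_def\<close>)

definition K :: nat where
  "K = 2 ^ Suc m - 1"

lemma K_gt_1: "1 < K"
  using D_ge_3 unfolding K_def by linarith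

lemma Suc_K: "2 ^ Suc m = Suc K"
  by (simp add: K_def)

lemma S_less_K: "S (length x) < K"
proof -
  have "(2::nat) \<le> 2 ^ m"
    using power_increasing [of 1 m "2::nat"] m_bounds(2) by simp
  then show ?thesis
    using m_bounds(1) unfolding K_def power_Suc by linarith
qed

lemma head_less_K: "run M x k = (q, [(c, p)]) \<Longrightarrow> p < K"
  using space [unfolded space_bounded_def, rule_format, of "(c, p)" x k] S_less_K by simp

text \<open>The induction is on the index in the word rather than on time, because the last cell of
  a row has the first cell of the row under construction as its right neighbour.\<close>

lemma cell_eq_cell_sym: "i < K \<Longrightarrow> cell (1 + k * K + i) = cell_sym (run M x k) i"
proof (induction "k * K + i" arbitrary: k i rule: less_induct)
  case less
  show ?case
  proof (cases k)
    case 0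
    \<comment> \<open>The dummy blank and the \<open>K\<close> cells of the first row exactly fill
      the \<open>K + 1\<close> initial values.\<close>
    have "cell (1 + i) = row0 (1 + i)"
      using less.prems Suc_K by (intro cell_init) auto
    also have "\<dots> = cell_sym (run M x 0) i"
      unfolding row0_def
      by (auto simp: run_def init_def cell_sym_def contents_def bit_sym_def
          blank_sym_def start_sym_def)
    finally show ?thesis
      by (simp add: 0)
  next
    case (Suc j)
    obtain q c p where cfg: "run M x j = (q, [(c, p)])" "q < num_states M" "\<And>i. c i < num_syms M"
      using run_single [OF M] by blast
    let ?d = "j * K + i"
    \<comment> \<open>A step of \<open>K + 1\<close> back leads to the left neighbour of the same
      cell one row earlier, so the cell itself is the middle argument of the rule.\<close>
    have "1 + k * K + i = ?d + 2 ^ Suc m"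
      by (simp add: Suc Suc_K del: power_Suc)
    then have "cell (1 + k * K + i) = local_rule M (cell ?d) (cell (?d + 1)) (cell (?d + 2))"
      by (simp only: cell_step)
    also have "cell (?d + 1) = cell_sym (run M x j) i"
      using less.hyps [of j i] less.prems by (simp add: Suc)
    also have "local_rule M (cell ?d) (cell_sym (run M x j) i) (cell (?d + 2)) =
        cell_sym (step M (run M x j)) i"
    proof (rule cell_sym_step [OF M cfg, symmetric])
      assume "i > 0"
      then show "cell ?d = cell_sym (run M x j) (i - 1)"
        using less.hyps [of j "i - 1"] less.prems by (simp add: Suc)
    next
      show "cell (?d + 2) = cell_sym (run M x j) (i + 1) \<or> tsym_z (cell (?d + 2)) = 1 \<and> p \<noteq> i + 1"
      proof (cases "i + 1 < K")
        case True
        then show ?thesis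
          using less.hyps [of j "i + 1"] K_gt_1 by (simp add: Suc)
      next
        case False
        then have i: "Suc i = K"
          using less.prems by simp
        then have "?d + 2 = 1 + k * K + 0"
          by (simp add: Suc)
        moreover have "cell (1 + k * K + 0) = cell_sym (run M x k) 0"
          using i K_gt_1 by (intro less.hyps) auto
        ultimately have "cell (?d + 2) = cell_sym (run M x k) 0"
          by simp
        \<comment> \<open>This is where the space bound enters: the head never visits cell
          \<open>K\<close>.\<close>
        moreover have "p \<noteq> i + 1"
          using head_less_K [OF cfg(1)] i by simp
        ultimately show ?thesis
          by (simp add: cell_sym_def)
      qed
    qed
    finally show ?thesis
      by (simp add: Suc run_def)
  qed
qed

text \<open>The symbols in \<open>acc_syms M\<close> carry the head in the accepting state. Without
  the dummy, division of the index by \<open>K\<close> gives time and position.\<close>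

lemma cell_acc_iff: "(\<exists>c. cell c \<in> set (acc_syms M)) \<longleftrightarrow> (\<exists>k. fst (run M x k) = accept M)"
proof
  assume "\<exists>c. cell c \<in> set (acc_syms M)"
  then obtain c where c: "cell c \<in> set (acc_syms M)"
    by blast
  have "cell 0 = tsym 0 0 0"
    unfolding blank_sym_def [symmetric] by (simp add: cell_init row0_def)
  then have "c \<noteq> 0"
    using c by (intro notI) (auto simp: acc_syms_def)
  then obtain d where d: "c = Suc d"
    by (cases c) auto
  define k i where "k = d div K" and "i = d mod K"
  have "i < K" "c = 1 + k * K + i"
    using K_gt_1 by (simp_all add: k_def i_def d)
  then have "cell_sym (run M x k) i \<in> set (acc_syms M)"
    using c cell_eq_cell_sym by metis
  then show "\<exists>k. fst (run M x k) = accept M"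
    by (auto simp: acc_syms_def cell_sym_def split: if_splits)
next
  assume "\<exists>k. fst (run M x k) = accept M"
  then obtain k where k: "fst (run M x k) = accept M"
    by blast
  obtain q c p where cfg: "run M x k = (q, [(c, p)])" "q < num_states M" "\<And>i. c i < num_syms M"
    using run_single [OF M] by blast
  have "cell (1 + k * K + p) = cell_sym (run M x k) p"
    using cfg by (intro cell_eq_cell_sym head_less_K)
  also have "\<dots> \<in> set (acc_syms M)"
    using k cfg by (auto simp: cell_sym_def acc_syms_def)
  finally show "\<exists>c. cell c \<in> set (acc_syms M)"
    by blast
qed

end


section \<open>Loop programs on Turing machines\<close>

text \<open>A loop runs its first body for each bit 0 and its second body for each bit 1 of its tape.
  As the bodies of a well-formed program do not touch that tape, \<open>exec\<close> may fold over its
  contents at the start of the loop.\<close>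

datatype prog = Nop | App nat bool | Seq prog prog | Loop nat prog prog

primrec exec :: "prog \<Rightarrow> (nat \<Rightarrow> bool list) \<Rightarrow> nat \<Rightarrow> bool list" where
  "exec Nop s = s"
| "exec (App t b) s = s(t := s t @ [b])"
| "exec (Seq p q) s = exec q (exec p s)"
| "exec (Loop t p q) s = fold (\<lambda>b. if b then exec q else exec p) (s t) s"

text \<open>The set \<open>A\<close> collects the tapes that enclosing loops are reading. Their
  heads stand inside the data, so nothing may be appended there and no inner loop may use
  them.\<close>

primrec wf_prog :: "nat \<Rightarrow> nat set \<Rightarrow> prog \<Rightarrow> bool" where
  "wf_prog k A Nop \<longleftrightarrow> True"
| "wf_prog k A (App t b) \<longleftrightarrow> t < k \<and> t \<notin> A"
| "wf_prog k A (Seq p q) \<longleftrightarrow> wf_prog k A p \<and> wf_prog k A q"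
| "wf_prog k A (Loop t p q) \<longleftrightarrow> t < k \<and> t \<notin> A \<and>
     wf_prog k (insert t A) p \<and> wf_prog k (insert t A) q"

primrec loops :: "prog \<Rightarrow> nat set" where
  "loops Nop = {}"
| "loops (App t b) = {}"
| "loops (Seq p q) = loops p \<union> loops q"
| "loops (Loop t p q) = insert t (loops p \<union> loops q)"

text \<open>\<open>N\<close> bounds the lengths of the loop tapes. A loop takes at most
  \<open>N + 2\<close> steps to rewind; each cell costs two steps for \<open>Branch\<close> and
  \<open>Advance\<close> and at most the sum of both bodies; the last \<open>Branch\<close> adds
  one.\<close>

primrec cost :: "prog \<Rightarrow> nat \<Rightarrow> nat" where
  "cost Nop N = 0"
| "cost (App t b) N = 1"
| "cost (Seq p q) N = cost p N + cost q N"
| "cost (Loop t p q) N = (N + 2) + (N * (2 + cost p N + cost q N) + 1)"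

primrec plen :: "prog \<Rightarrow> nat" where
  "plen Nop = 0"
| "plen (App t b) = 1"
| "plen (Seq p q) = plen p + plen q"
| "plen (Loop t p q) = plen p + plen q + 4"

lemma cost_poly: "\<exists>P :: nat poly. \<forall>N. cost p N = poly P N"
proof (induction p)
  case Nop
  show ?case
    by (rule exI [of _ 0]) simp
next
  case (App t b)
  show ?case
    by (rule exI [of _ 1]) simp
next
  case (Seq p q)
  then obtain P Q where "\<forall>N. cost p N = poly P N" "\<forall>N. cost q N = poly Q N"
    by blast
  then show ?case
    by (intro exI [of _ "P + Q"]) simp
next
  case (Loop t p q)
  then obtain P Q where "\<forall>N. cost p N = poly P N" "\<forall>N. cost q N = poly Q N"
    by blast
  then show ?case
    by (intro exI [of _ "[:3, 1:] + [:0, 1:] * ([:2:] + P + Q)"]) simp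
qed

lemma exec_frame: "wf_prog k A p \<Longrightarrow> t \<in> A \<Longrightarrow> exec p s t = s t"
proof (induction p arbitrary: A s)
  case (Loop u p q)
  have "fold (\<lambda>b. if b then exec q else exec p) ys s t = s t" for ys s
    using Loop by (induction ys arbitrary: s) auto
  then show ?case
    by simp
qed auto

lemma length_exec: "length (s t) \<le> length (exec p s t)"
proof (induction p arbitrary: s)
  case (Seq p q)
  show ?case
    using Seq.IH(1) [of s] Seq.IH(2) [of "exec p s"] by simp
next
  case (Loop u p q)
  have "length (s t) \<le> length (fold (\<lambda>b. if b then exec q else exec p) ys s t)" for ys s
  proof (induction ys arbitrary: s)
    case (Cons b ys)
    have "length (s t) \<le> length ((if b then exec q else exec p) s t)"
      using Loop.IH by simp
    also note Cons.IH
    finally show ?case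
      by simp
  qed simp
  then show ?case
    by simp
qed auto

lemma length_fold_exec:
  "length (s t) \<le> length (fold (\<lambda>b. if b then exec q else exec p) ys s t)"
proof (induction ys arbitrary: s)
  case (Cons b ys)
  have "length (s t) \<le> length ((if b then exec q else exec p) s t)"
    using length_exec by simp
  also note Cons.IH
  finally show ?case
    by simp
qed simp

section \<open>Instructions and their Turing machines\<close>

datatype instr =
  Write nat bool | Rewind nat | Scan nat | Branch nat nat nat nat | Advance nat nat

primrec tape_of :: "instr \<Rightarrow> nat" where
  "tape_of (Write t b) = t"
| "tape_of (Rewind t) = t"
| "tape_of (Scan t) = t"
| "tape_of (Branch t l l' l'') = t"
| "tape_of (Advance t l) = t"

text \<open>Symbol 1 is the left end, 0 the blank behind the data, 2 and 3 are the bits.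
  \<open>Rewind\<close> stops on the first cell after the left end; the third exit of
  \<open>Branch\<close> is taken at the end of the data.\<close>

primrec effect :: "instr \<Rightarrow> nat \<Rightarrow> nat \<Rightarrow> nat \<times> nat \<times> dir" where
  "effect (Write t b) pc r = (pc + 1, if b then 3 else 2, Rgt)"
| "effect (Rewind t) pc r = (if r = 1 then (pc + 1, r, Rgt) else (pc, r, Lft))"
| "effect (Scan t) pc r = (if r = 0 then (pc + 1, r, Stay) else (pc, r, Rgt))"
| "effect (Branch t l l' l'') pc r = (if r = 2 then l else if r = 3 then l' else l'', r, Stay)"
| "effect (Advance t l) pc r = (l, r, Rgt)"

text \<open>The \<open>min\<close> keeps all jumps within the set of states, as
  \<open>turing_machine\<close> demands for arbitrary code. Running off the end leads to
  \<open>length C\<close>, the accepting state of \<open>machine\<close>.\<close>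

definition code_trans :: "instr list \<Rightarrow> nat \<Rightarrow> nat list \<Rightarrow> nat \<times> (nat \<times> dir) list" where
  "code_trans C pc as = (if pc < length C then
       (case effect (C ! pc) pc (as ! tape_of (C ! pc)) of (pc', ad) \<Rightarrow>
          (min pc' (length C), (map (\<lambda>a. (a, Stay)) as)[tape_of (C ! pc) := ad]))
     else (pc, map (\<lambda>a. (a, Stay)) as))"

definition machine :: "nat \<Rightarrow> instr list \<Rightarrow> tm" where
  "machine k C = \<lparr>num_tapes = k, num_syms = 4, num_states = length C + 2,
     accept = length C, reject = length C + 1, trans = code_trans C\<rparr>"

lemma turing_machine_machine:
  assumes "1 \<le> k"
  shows "turing_machine (machine k C)"
proof -
  have "case code_trans C q as of (q', acts) \<Rightarrow>
      q' < length C + 2 \<and> length acts = k \<and> (\<forall>(a, d) \<in> set acts. a < 4)"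
    if "q < length C + 2" "length as = k" "\<forall>a \<in> set as. a < 4" for q as
  proof (cases "q < length C")
    case True
    obtain q' a d where eff: "effect (C ! q) q (as ! tape_of (C ! q)) = (q', a, d)"
      by (cases "effect (C ! q) q (as ! tape_of (C ! q))") auto
    have "a < 4" if "tape_of (C ! q) < length as"
    proof -
      have "as ! tape_of (C ! q) < 4"
        using that \<open>\<forall>a \<in> set as. a < 4\<close> by simp
      then show ?thesis
        using eff by (cases "C ! q") (auto split: if_splits)
    qed
    then have "\<forall>(b, e) \<in> set ((map (\<lambda>a. (a, Stay)) as)[tape_of (C ! q) := (a, d)]). b < 4"
      using that(3) set_update_subset_insert [of "map (\<lambda>a. (a, Stay)) as" "tape_of (C ! q)" "(a, d)"]
      by (cases "tape_of (C ! q) < length as") (auto simp: list_update_beyond)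
    then show ?thesis
      using True that eff by (simp add: code_trans_def)
  next
    case False
    then show ?thesis
      using that by (auto simp: code_trans_def)
  qed
  then show ?thesis
    using assms unfolding turing_machine_def machine_def by simp
qed

lemma step_machine:
  assumes "pc < length C" "length tps = k" "tape_of (C ! pc) < k"
    and eff: "effect (C ! pc) pc (read (tps ! tape_of (C ! pc))) = (pc', ad)" "pc' \<le> length C"
  shows "step (machine k C) (pc, tps) =
    (pc', tps[tape_of (C ! pc) := act ad (tps ! tape_of (C ! pc))])"
proof -
  let ?t = "tape_of (C ! pc)"
  have Stay: "act (read \<tau>, Stay) \<tau> = \<tau>" for \<tau>
    by (cases \<tau>) simp
  have "map2 act ((map (\<lambda>a. (a, Stay)) (map read tps))[?t := ad]) tps = tps[?t := act ad (tps ! ?t)]"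
    using assms(2,3) by (intro nth_equalityI) (auto simp: nth_list_update Stay)
  then show ?thesis
    using assms by (simp add: step_def halted_def machine_def code_trans_def)
qed

definition reaches :: "tm \<Rightarrow> nat \<Rightarrow> config \<Rightarrow> config \<Rightarrow> bool" where
  "reaches M B cfg cfg' \<longleftrightarrow> (\<exists>n \<le> B. (step M ^^ n) cfg = cfg')"

lemma reaches_refl: "reaches M B cfg cfg"
  by (auto simp: reaches_def intro: exI [of _ 0])

lemma reaches_trans:
  assumes "reaches M B cfg cfg'" "reaches M B' cfg' cfg''"
  shows "reaches M (B + B') cfg cfg''"
proof -
  from assms obtain n n' where "n \<le> B" "n' \<le> B'" "(step M ^^ n) cfg = cfg'"
    "(step M ^^ n') cfg' = cfg''"
    by (auto simp: reaches_def)
  then show ?thesis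
    unfolding reaches_def by (intro exI [of _ "n' + n"]) (simp add: funpow_add)
qed

lemma reaches_mono: "reaches M B cfg cfg' \<Longrightarrow> B \<le> B' \<Longrightarrow> reaches M B' cfg cfg'"
  by (auto simp: reaches_def intro: le_trans)

lemma reaches_machine:
  assumes "pc < length C" "length tps = k" "tape_of (C ! pc) < k"
    and "effect (C ! pc) pc (read (tps ! tape_of (C ! pc))) = (pc', ad)" "pc' \<le> length C"
  shows "reaches (machine k C) 1 (pc, tps)
    (pc', tps[tape_of (C ! pc) := act ad (tps ! tape_of (C ! pc))])"
  unfolding reaches_def using step_machine [OF assms] by (intro exI [of _ 1]) simp

lemma contents_0 [simp]: "contents xs 0 = 1"
  by (simp add: contents_def)

lemma contents_Suc: "contents xs (Suc i) = (if i < length xs then if xs ! i then 3 else 2 else 0)"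
  by (simp add: contents_def)

lemma contents_snoc: "contents (xs @ [b]) = (contents xs)(Suc (length xs) := if b then 3 else 2)"
  by (rule ext) (auto simp: contents_def nth_append)

lemma reaches_Rewind:
  assumes C: "pc < length C" "C ! pc = Rewind t"
    and tps: "length tps = k" "t < k" "tps ! t = (contents xs, p)"
  shows "reaches (machine k C) (p + 1) (pc, tps) (Suc pc, tps[t := (contents xs, 1)])"
  using tps
proof (induction p arbitrary: tps)
  case 0
  then show ?case
    using reaches_machine [of pc C tps k "Suc pc" "(1, Rgt)"] C by (simp add: fun_upd_idem)
next
  case (Suc p)
  have "reaches (machine k C) 1 (pc, tps) (pc, tps[t := (contents xs, p)])"
    using reaches_machine [of pc C tps k pc "(contents xs (Suc p), Lft)"] C Suc.prems
    by (simp add: contents_Suc fun_upd_idem)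
  moreover have "reaches (machine k C) (p + 1) (pc, tps[t := (contents xs, p)])
      (Suc pc, tps[t := (contents xs, 1)])"
    using Suc.IH [of "tps[t := (contents xs, p)]"] Suc.prems by simp
  ultimately show ?case
    using reaches_trans by fastforce
qed

lemma reaches_Scan:
  assumes C: "pc < length C" "C ! pc = Scan t"
    and tps: "length tps = k" "t < k" "tps ! t = (contents xs, p)" "p + d = Suc (length xs)"
  shows "reaches (machine k C) (d + 1) (pc, tps) (Suc pc, tps[t := (contents xs, Suc (length xs))])"
  using tps
proof (induction d arbitrary: p tps)
  case 0
  then show ?case
    using reaches_machine [of pc C tps k "Suc pc" "(0, Stay)"] C
    by (simp add: contents_Suc fun_upd_idem)
next
  case (Suc d)
  have "contents xs p \<noteq> 0"
    using Suc.prems by (cases p) (auto simp: contents_Suc)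
  then have "reaches (machine k C) 1 (pc, tps) (pc, tps[t := (contents xs, Suc p)])"
    using reaches_machine [of pc C tps k pc "(contents xs p, Rgt)"] C Suc.prems
    by (simp add: fun_upd_idem)
  moreover have "reaches (machine k C) (d + 1) (pc, tps[t := (contents xs, Suc p)])
      (Suc pc, tps[t := (contents xs, Suc (length xs))])"
    using Suc.IH [of "tps[t := (contents xs, Suc p)]" "Suc p"] Suc.prems by simp
  ultimately show ?case
    using reaches_trans by fastforce
qed

section \<open>Compilation of loop programs\<close>

primrec comp :: "prog \<Rightarrow> nat \<Rightarrow> instr list" where
  "comp Nop l = []"
| "comp (App t b) l = [Write t b]"
| "comp (Seq p q) l = comp p l @ comp q (l + plen p)"
| "comp (Loop t p q) l =
     [Rewind t, Branch t (l + 2) (l + plen p + 3) (l + plen p + plen q + 4)] @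
     comp p (l + 2) @ [Advance t (l + 1)] @ comp q (l + plen p + 3) @ [Advance t (l + 1)]"

lemma length_comp [simp]: "length (comp p l) = plen p"
  by (induction p arbitrary: l) auto

definition code_at :: "instr list \<Rightarrow> nat \<Rightarrow> instr list \<Rightarrow> bool" where
  "code_at C l c \<longleftrightarrow> l + length c \<le> length C \<and> take (length c) (drop l C) = c"

lemma code_at_append:
  "code_at C l (c @ c') \<longleftrightarrow> code_at C l c \<and> code_at C (l + length c) c'"
  by (auto simp: code_at_def take_add add.commute)

lemma code_at_Cons:
  "code_at C l (i # c) \<longleftrightarrow> l < length C \<and> C ! l = i \<and> code_at C (Suc l) c"
proof -
  have "code_at C l [i] \<longleftrightarrow> l < length C \<and> C ! l = i"
    by (auto simp: code_at_def take_Suc_conv_app_nth)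
  then show ?thesis
    using code_at_append [of C l "[i]" c] by simp
qed

lemma code_at_le: "code_at C l c \<Longrightarrow> l + length c \<le> length C"
  by (simp add: code_at_def)

text \<open>Outside \<open>A\<close> every head is on the first blank, ready for appending. The
  tapes in \<open>A\<close> are left unspecified, because enclosing loops have their heads inside
  the data.\<close>

definition represents :: "nat \<Rightarrow> nat set \<Rightarrow> (nat \<Rightarrow> bool list) \<Rightarrow> tape list \<Rightarrow> bool" where
  "represents k A s tps \<longleftrightarrow> length tps = k \<and>
     (\<forall>i < k. i \<notin> A \<longrightarrow> tps ! i = (contents (s i), Suc (length (s i))))"

text \<open>The tapes in \<open>A\<close> must come back with contents and heads unchanged, so that
  the enclosing loops can resume.\<close>

lemma reaches_comp:
  assumes "wf_prog k A p" "code_at C l (comp p l)" "represents k A s tps"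
    and "\<And>t. t \<in> loops p \<Longrightarrow> length (exec p s t) \<le> N"
  shows "\<exists>tps'. reaches (machine k C) (cost p N) (l, tps) (l + plen p, tps') \<and>
    represents k A (exec p s) tps' \<and> (\<forall>i \<in> A. i < k \<longrightarrow> tps' ! i = tps ! i)"
  using assms
proof (induction p arbitrary: l A s tps)
  case Nop
  then show ?case
    by (auto intro: reaches_refl)
next
  case (App t b)
  let ?tps = "tps[t := (contents (s t @ [b]), Suc (Suc (length (s t))))]"
  have "reaches (machine k C) 1 (l, tps) (Suc l, ?tps)"
    using App.prems reaches_machine [of l C tps k "Suc l" "(if b then 3 else 2, Rgt)"]
    by (auto simp: code_at_Cons represents_def contents_snoc)
  moreover have "represents k A (exec (App t b) s) ?tps" "\<forall>i \<in> A. i < k \<longrightarrow> ?tps ! i = tps ! i"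
    using App.prems by (auto simp: represents_def nth_list_update)
  ultimately show ?case
    by (intro exI [of _ ?tps]) (simp add: fun_upd_def)
next
  case (Seq p q)
  have "length (exec p s t) \<le> N" if "t \<in> loops p" for t
    using length_exec [of "exec p s" t q] Seq.prems(4) [of t] that by simp
  then obtain tps1 where 1: "reaches (machine k C) (cost p N) (l, tps) (l + plen p, tps1)"
    "represents k A (exec p s) tps1" "\<forall>i \<in> A. i < k \<longrightarrow> tps1 ! i = tps ! i"
    using Seq.IH(1) [of A l s tps] Seq.prems by (auto simp: code_at_append)
  obtain tps2 where 2: "reaches (machine k C) (cost q N) (l + plen p, tps1) (l + plen p + plen q, tps2)"
    "represents k A (exec q (exec p s)) tps2" "\<forall>i \<in> A. i < k \<longrightarrow> tps2 ! i = tps1 ! i"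
    using Seq.IH(2) [of A "l + plen p" "exec p s" tps1] Seq.prems 1 by (auto simp: code_at_append)
  show ?case
    using reaches_trans [OF 1(1) 2(1)] 1 2 by (intro exI [of _ tps2]) (auto simp: add.assoc)
next
  case (Loop t p q)
  let ?M = "machine k C"
  let ?body = "\<lambda>b. if b then exec q else exec p"
  let ?lp = "l + 2" and ?lq = "l + plen p + 3" and ?le = "l + plen p + plen q + 4"
  define xs where "xs = s t"
  have t: "t < k" "t \<notin> A" and wf: "wf_prog k (insert t A) p" "wf_prog k (insert t A) q"
    using Loop.prems(1) by auto
  have C: "l < length C" "C ! l = Rewind t"
      "Suc l < length C" "C ! Suc l = Branch t ?lp ?lq ?le"
      "code_at C ?lp (comp p ?lp)" "?lp + plen p < length C" "C ! (?lp + plen p) = Advance t (l + 1)"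
      "code_at C ?lq (comp q ?lq)" "?lq + plen q < length C" "C ! (?lq + plen q) = Advance t (l + 1)"
      "?le \<le> length C"
    using Loop.prems(2) code_at_le [OF Loop.prems(2)]
    by (simp_all add: code_at_append code_at_Cons eval_nat_numeral)
  have tps: "length tps = k" "tps ! t = (contents xs, Suc (length xs))"
    using Loop.prems(3) t by (auto simp: represents_def xs_def)
  \<comment> \<open>An inner induction on the unread part \<open>ys\<close> of the loop tape;
    \<open>zs\<close> has been read, so the head is on cell \<open>Suc (length zs)\<close>.\<close>
  have iter: "\<exists>tps'. reaches ?M (length ys * (2 + cost p N + cost q N) + 1) (Suc l, tps1) (?le, tps') \<and>
      represents k (insert t A) (fold ?body ys s1) tps' \<and>
      tps' ! t = (contents xs, Suc (length xs)) \<and> (\<forall>i \<in> A. i < k \<longrightarrow> tps' ! i = tps1 ! i)"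
    if "xs = zs @ ys" "represents k (insert t A) s1 tps1" "tps1 ! t = (contents xs, Suc (length zs))"
      "\<And>u. u \<in> loops p \<union> loops q \<Longrightarrow> length (fold ?body ys s1 u) \<le> N"
    for ys zs s1 tps1
    using that
  proof (induction ys arbitrary: zs s1 tps1)
    case Nil
    have len: "length tps1 = k"
      using Nil.prems by (simp add: represents_def)
    have "reaches ?M 1 (Suc l, tps1) (?le, tps1[t := (contents xs, Suc (length zs))])"
      using reaches_machine [of "Suc l" C tps1 k ?le "(0, Stay)"] C len t Nil.prems
      by (simp add: contents_Suc fun_upd_idem)
    moreover have "tps1[t := (contents xs, Suc (length zs))] = tps1"
      using Nil.prems by (metis list_update_id)
    ultimately show ?case
      using Nil.prems by (intro exI [of _ tps1]) simp
  next
    case (Cons b ys)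
    have len: "length tps1 = k"
      using Cons.prems by (simp add: represents_def)
    have b: "contents xs (Suc (length zs)) = (if b then 3 else 2)"
      using Cons.prems by (simp add: contents_Suc)
    define r where "r = (if b then q else p)"
    define lr where "lr = (if b then ?lq else ?lp)"
    have body: "?body b = exec r"
      by (simp add: r_def)
    have "reaches ?M 1 (Suc l, tps1) (lr, tps1[t := (contents xs, Suc (length zs))])"
      using reaches_machine [of "Suc l" C tps1 k lr "(if b then 3 else 2, Stay)"] C len t Cons.prems b
      by (auto simp: lr_def fun_upd_idem)
    moreover have "tps1[t := (contents xs, Suc (length zs))] = tps1"
      using Cons.prems by (metis list_update_id)
    ultimately have 1: "reaches ?M 1 (Suc l, tps1) (lr, tps1)"
      by simp
    \<comment> \<open>As tapes only grow, the bound \<open>N\<close> on the final lengths also holds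
      after a single round.\<close>
    have bnd: "length (exec r s1 u) \<le> N" if "u \<in> loops p \<union> loops q" for u
    proof -
      have "length (exec r s1 u) \<le> length (fold ?body ys (exec r s1) u)"
        by (rule length_fold_exec)
      also have "\<dots> \<le> N"
        using Cons.prems(4) [OF that] body by simp
      finally show ?thesis .
    qed
    have "\<exists>tps2. reaches ?M (cost r N) (lr, tps1) (lr + plen r, tps2) \<and>
        represents k (insert t A) (exec r s1) tps2 \<and>
        (\<forall>i \<in> insert t A. i < k \<longrightarrow> tps2 ! i = tps1 ! i)"
    proof (cases b)
      case True
      then show ?thesis
        using Loop.IH(2) [of "insert t A" ?lq s1 tps1] wf C Cons.prems(2) bnd
        by (simp add: r_def lr_def)
    next
      case False
      then show ?thesis
        using Loop.IH(1) [of "insert t A" ?lp s1 tps1] wf C Cons.prems(2) bnd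
        by (simp add: r_def lr_def)
    qed
    then obtain tps2 where 2: "reaches ?M (cost r N) (lr, tps1) (lr + plen r, tps2)"
        "represents k (insert t A) (exec r s1) tps2"
        "\<And>i. i \<in> insert t A \<Longrightarrow> i < k \<Longrightarrow> tps2 ! i = tps1 ! i"
      by blast
    define tps3 where "tps3 = tps2[t := (contents xs, Suc (Suc (length zs)))]"
    have len2: "length tps2 = k" and tps2: "tps2 ! t = (contents xs, Suc (length zs))"
      using 2 t Cons.prems by (auto simp: represents_def)
    have adv: "lr + plen r < length C" "C ! (lr + plen r) = Advance t (l + 1)"
      using C by (auto simp: lr_def r_def)
    have 3: "reaches ?M 1 (lr + plen r, tps2) (Suc l, tps3)"
      using reaches_machine [of "lr + plen r" C tps2 k "Suc l" "(contents xs (Suc (length zs)), Rgt)"]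
        adv len2 t tps2 C(3)
      by (simp add: tps3_def fun_upd_idem)
    have rep3: "represents k (insert t A) (exec r s1) tps3"
      using 2(2) by (auto simp: represents_def tps3_def)
    have "\<exists>tps'. reaches ?M (length ys * (2 + cost p N + cost q N) + 1) (Suc l, tps3) (?le, tps') \<and>
        represents k (insert t A) (fold ?body ys (exec r s1)) tps' \<and>
        tps' ! t = (contents xs, Suc (length xs)) \<and> (\<forall>i \<in> A. i < k \<longrightarrow> tps' ! i = tps3 ! i)"
    proof (rule Cons.IH [of "zs @ [b]"])
      show "tps3 ! t = (contents xs, Suc (length (zs @ [b])))"
        using t len2 by (simp add: tps3_def)
      show "length (fold ?body ys (exec r s1) u) \<le> N" if "u \<in> loops p \<union> loops q" for u
        using Cons.prems(4) [OF that] body by simp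
    qed (use Cons.prems rep3 in auto)
    then obtain tps' where 4: "reaches ?M (length ys * (2 + cost p N + cost q N) + 1) (Suc l, tps3) (?le, tps')"
        "represents k (insert t A) (fold ?body ys (exec r s1)) tps'"
        "tps' ! t = (contents xs, Suc (length xs))" "\<forall>i \<in> A. i < k \<longrightarrow> tps' ! i = tps3 ! i"
      by blast
    have "reaches ?M (1 + (cost r N + (1 + (length ys * (2 + cost p N + cost q N) + 1))))
        (Suc l, tps1) (?le, tps')"
      by (intro reaches_trans [OF 1] reaches_trans [OF 2(1)] reaches_trans [OF 3] 4(1))
    then have "reaches ?M (length (b # ys) * (2 + cost p N + cost q N) + 1) (Suc l, tps1) (?le, tps')"
      by (rule reaches_mono) (auto simp: r_def)
    moreover have "tps' ! i = tps1 ! i" if "i \<in> A" "i < k" for i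
    proof -
      have "i \<noteq> t"
        using that t by auto
      then show ?thesis
        using 2(3) 4(4) that by (simp add: tps3_def)
    qed
    ultimately show ?case
      using 4 body by (intro exI [of _ tps']) simp
  qed
  define tps1 where "tps1 = tps[t := (contents xs, 1)]"
  have 1: "reaches ?M (Suc (length xs) + 1) (l, tps) (Suc l, tps1)"
    unfolding tps1_def using C t tps by (intro reaches_Rewind) auto
  have "\<exists>tps'. reaches ?M (length xs * (2 + cost p N + cost q N) + 1) (Suc l, tps1) (?le, tps') \<and>
      represents k (insert t A) (fold ?body xs s) tps' \<and>
      tps' ! t = (contents xs, Suc (length xs)) \<and> (\<forall>i \<in> A. i < k \<longrightarrow> tps' ! i = tps1 ! i)"
  proof (rule iter [of "[]"])
    show "represents k (insert t A) s tps1"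
      using Loop.prems(3) by (auto simp: represents_def tps1_def)
    show "tps1 ! t = (contents xs, Suc (length []))"
      using t tps by (simp add: tps1_def)
    show "length (fold ?body xs s u) \<le> N" if "u \<in> loops p \<union> loops q" for u
      using Loop.prems(4) [of u] that by (simp add: xs_def)
  qed simp
  then obtain tps' where 2: "reaches ?M (length xs * (2 + cost p N + cost q N) + 1) (Suc l, tps1) (?le, tps')"
      "represents k (insert t A) (fold ?body xs s) tps'"
      "tps' ! t = (contents xs, Suc (length xs))" "\<forall>i \<in> A. i < k \<longrightarrow> tps' ! i = tps1 ! i"
    by blast
  have N: "length xs \<le> N"
    using length_exec [of s t "Loop t p q"] Loop.prems(4) [of t] by (simp add: xs_def)
  have "reaches ?M (cost (Loop t p q) N) (l, tps) (?le, tps')"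
    using reaches_trans [OF 1 2(1)] by (rule reaches_mono) (use N in \<open>simp add: add_mono mult_le_mono1\<close>)
  moreover have "exec (Loop t p q) s = fold ?body xs s"
    by (simp add: xs_def)
  \<comment> \<open>The bodies do not touch tape \<open>t\<close>, and the loop ends on its first
    blank, so \<open>t\<close> is ready for appending again.\<close>
  moreover have "fold ?body ys s' t = s' t" for ys s'
    by (induction ys arbitrary: s') (use wf in \<open>auto simp: exec_frame\<close>)
  then have "fold ?body xs s t = xs"
    by (simp add: xs_def)
  then have "represents k A (fold ?body xs s) tps'"
    using 2(2,3) by (auto simp: represents_def)
  moreover have "tps' ! i = tps ! i" if "i \<in> A" "i < k" for i
    using 2(4) that t by (metis nth_list_update_neq tps1_def)
  ultimately show ?case
    by (intro exI [of _ tps']) (simp add: algebra_simps)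
qed

section \<open>Loop programs with polynomially bounded tapes run in polynomial time\<close>

definition start_store :: "bool list \<Rightarrow> nat \<Rightarrow> bool list" where
  "start_store x t = (if t = 0 then x else [])"

text \<open>All heads start on cell 0; one \<open>Scan\<close> per tape takes each to its first
  blank, within \<open>length x + 2\<close> steps.\<close>

lemma reaches_prelude:
  assumes "1 \<le> k" "code_at C 0 (map Scan [0..<k])" "j \<le> k"
  shows "reaches (machine k C) (j * (length x + 2)) (init (machine k C) x)
    (j, map (\<lambda>i. (contents (start_store x i), if i < j then Suc (length (start_store x i)) else 0)) [0..<k])"
  using assms(3)
proof (induction j)
  case 0
  have "init (machine k C) x = (0, map (\<lambda>i. (contents (start_store x i), 0)) [0..<k])"
    using assms(1) by (auto simp: init_def machine_def start_store_def nth_Cons' intro!: nth_equalityI)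
  then show ?case
    by (simp add: reaches_refl)
next
  case (Suc j)
  let ?T = "\<lambda>j. map (\<lambda>i. (contents (start_store x i), if i < j then Suc (length (start_store x i)) else 0)) [0..<k]"
  have j: "j < k"
    using Suc.prems by simp
  have C: "j < length C" "C ! j = Scan j"
  proof -
    have len: "k \<le> length C" and tk: "take k C = map Scan [0..<k]"
      using assms(2) by (auto simp: code_at_def)
    show "j < length C"
      using len j by simp
    have "C ! j = take k C ! j"
      using j by simp
    also have "\<dots> = Scan j"
      using j by (simp add: tk)
    finally show "C ! j = Scan j" .
  qed
  have "reaches (machine k C) (Suc (length (start_store x j)) + 1) (j, ?T j)
      (Suc j, (?T j)[j := (contents (start_store x j), Suc (length (start_store x j)))])"
    using C j by (intro reaches_Scan) auto
  moreover have "(?T j)[j := (contents (start_store x j), Suc (length (start_store x j)))] = ?T (Suc j)"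
    using j by (intro nth_equalityI) (auto simp: nth_list_update)
  ultimately have "reaches (machine k C) (length x + 2) (j, ?T j) (Suc j, ?T (Suc j))"
    by (auto simp: start_store_def intro: reaches_mono)
  from reaches_trans [OF Suc.IH this] Suc.prems show ?case
    by (simp add: ac_simps)
qed

lemma polytime_exec:
  fixes Q :: "nat poly"
  assumes wf: "wf_prog (Suc out) {} p"
    and Q: "\<And>x t. t \<in> loops p \<Longrightarrow> length (exec p (start_store x) t) \<le> poly Q (length x)"
  shows "polytime (\<lambda>x. exec p (start_store x) out)"
proof -
  let ?k = "Suc out"
  define C where "C = map Scan [0..<?k] @ comp p ?k"
  obtain P :: "nat poly" where P: "\<And>N. cost p N = poly P N"
    using cost_poly by blast
  \<comment> \<open>The first summand pays for the prelude, the second is \<open>cost p\<close> at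
    the length bound \<open>Q\<close>.\<close>
  define T where "T = [:of_nat (2 * ?k), of_nat ?k:] + pcompose P Q"
  have "computes_in_time (machine ?k C) (\<lambda>x. exec p (start_store x) out) (poly T)"
    unfolding computes_in_time_def
  proof
    fix x :: "bool list"
    let ?M = "machine ?k C"
    let ?N = "poly Q (length x)"
    let ?tps = "map (\<lambda>i. (contents (start_store x i), Suc (length (start_store x i)))) [0..<?k]"
    have at: "code_at C 0 (map Scan [0..<?k])" "code_at C ?k (comp p ?k)"
      unfolding C_def code_at_def by auto
    have "map (\<lambda>i. (contents (start_store x i), if i < ?k then Suc (length (start_store x i)) else 0)) [0..<?k] = ?tps"
      by (intro map_cong) auto
    then have 1: "reaches ?M (?k * (length x + 2)) (init ?M x) (?k, ?tps)"
      using reaches_prelude [OF _ at(1) le_refl, of x] by (simp only: le_add1 plus_1_eq_Suc)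
    have rep: "represents ?k {} (start_store x) ?tps"
      by (auto simp: represents_def simp del: upt_Suc)
    obtain tps' where 2: "reaches ?M (cost p ?N) (?k, ?tps) (?k + plen p, tps')"
        "represents ?k {} (exec p (start_store x)) tps'"
      using reaches_comp [OF wf at(2) rep, of ?N] Q by blast
    have "poly T (length x) = ?k * (length x + 2) + cost p ?N"
      by (simp add: T_def P poly_pcompose algebra_simps)
    with reaches_trans [OF 1 2(1)] obtain n where
      n: "n \<le> poly T (length x)" "run ?M x n = (?k + plen p, tps')"
      by (auto simp: reaches_def run_def)
    moreover have "halted ?M (?k + plen p, tps')"
      by (simp add: halted_def machine_def C_def)
    moreover have "fst (last tps') = contents (exec p (start_store x) out)"
    proof -
      have "length tps' = ?k" "tps' ! out = (contents (exec p (start_store x) out),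
          Suc (length (exec p (start_store x) out)))"
        using 2(2) by (auto simp: represents_def)
      then show ?thesis
        by (simp add: last_conv_nth flip: length_0_conv)
    qed
    ultimately show "\<exists>n \<le> poly T (length x). halted ?M (run ?M x n) \<and>
        fst (last (snd (run ?M x n))) = contents (exec p (start_store x) out)"
      by (intro exI [of _ n]) simp
  qed
  then show ?thesis
    unfolding polytime_def using turing_machine_machine [of ?k C] by auto
qed


section \<open>The reduction\<close>

lemma bits_double: "n > 0 \<Longrightarrow> bits (2 * n) = False # bits n"
  by (subst bits.simps) simp

lemma bits_Suc_double: "bits (Suc (2 * n)) = True # bits n"
  by (subst bits.simps) simp

text \<open>Bits are written least significant first, each after a continuation bit, so every factor
  2 contributes \<open>10\<close> and the odd part begins with \<open>11\<close>.\<close>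

lemma enc_nat_node:
  "enc_nat (node t j) = concat (replicate j [True, False]) @ [True, True] @ enc_nat t"
proof (induction j)
  case 0
  show ?case
    by (simp add: node_def enc_nat_def bits_Suc_double)
next
  case (Suc j)
  have "node t (Suc j) = 2 * node t j" "node t j > 0"
    by (simp_all add: node_def)
  then have "enc_nat (node t (Suc j)) = [True, False] @ enc_nat (node t j)"
    by (simp add: enc_nat_def bits_double)
  then show ?case
    by (simp add: Suc.IH)
qed

text \<open>Since \<open>node 0 j\<close> is \<open>2 ^ j\<close>, such a weight is printed like the
  vertex \<open>Low j\<close>, after a sign bit.\<close>

lemma enc_int_uminus_power: "enc_int (- (2 ^ j)) = True # enc_nat (node 0 j)"
  by (simp add: enc_int_def node_def nat_power_eq)

lemma enc_list_eq: "enc_list f xs = concat (map (\<lambda>x. True # f x) xs) @ [False]"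
  by (induction xs) auto

section \<open>Programs that print\<close>

primrec seqs :: "prog list \<Rightarrow> prog" where
  "seqs [] = Nop"
| "seqs (p # ps) = Seq p (seqs ps)"

definition str :: "nat \<Rightarrow> bool list \<Rightarrow> prog" where
  "str t bs = seqs (map (App t) bs)"

lemma exec_str [simp]: "exec (str t bs) s = s(t := s t @ bs)"
  by (induction bs arbitrary: s) (auto simp: str_def)

lemma wf_str [simp]: "wf_prog k A (str t bs) \<longleftrightarrow> bs = [] \<or> t < k \<and> t \<notin> A"
  by (induction bs) (auto simp: str_def)

lemma loops_str [simp]: "loops (str t bs) = {}"
  by (induction bs) (auto simp: str_def)

text \<open>\<open>Cnt t\<close> stands for as many copies of the code 10 of a zero bit as tape \<open>t\<close> has cells.\<close>

datatype item = Lit "bool list" | Cnt nat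

primrec item_val :: "(nat \<Rightarrow> bool list) \<Rightarrow> item \<Rightarrow> bool list" where
  "item_val s (Lit bs) = bs"
| "item_val s (Cnt t) = concat (replicate (length (s t)) [True, False])"

definition vals :: "(nat \<Rightarrow> bool list) \<Rightarrow> item list \<Rightarrow> bool list" where
  "vals s is = concat (map (item_val s) is)"

definition cnts :: "item list \<Rightarrow> nat set" where
  "cnts is = {t. Cnt t \<in> set is}"

lemma cnts_simps [simp]:
  "cnts [] = {}" "cnts (Lit bs # is) = cnts is" "cnts (Cnt t # is) = insert t (cnts is)"
  "cnts (is @ js) = cnts is \<union> cnts js"
  by (auto simp: cnts_def)

lemma vals_simps [simp]:
  "vals s [] = []" "vals s (i # is) = item_val s i @ vals s is"
  "vals s (is @ js) = vals s is @ vals s js"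
  by (simp_all add: vals_def)

lemma vals_fun_upd [simp]: "t \<notin> cnts is \<Longrightarrow> vals (s(t := w)) is = vals s is"
proof (induction "is")
  case (Cons i "is")
  then show ?case
    by (cases i) auto
qed simp

primrec emit1 :: "nat \<Rightarrow> item \<Rightarrow> prog" where
  "emit1 out (Lit bs) = str out bs"
| "emit1 out (Cnt t) = Loop t (str out [True, False]) (str out [True, False])"

definition emit :: "nat \<Rightarrow> item list \<Rightarrow> prog" where
  "emit out is = seqs (map (emit1 out) is)"

lemma exec_emit1: "i \<noteq> Cnt out \<Longrightarrow> exec (emit1 out i) s = s(out := s out @ item_val s i)"
proof (cases i)
  case (Cnt t)
  have "fold (\<lambda>b. if b then exec (str out [True, False]) else exec (str out [True, False])) ys s =
      s(out := s out @ concat (replicate (length ys) [True, False]))" for ys :: "bool list" and s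
    by (induction ys arbitrary: s) auto
  then show ?thesis
    by (simp add: Cnt)
qed simp

lemma exec_emit [simp]: "out \<notin> cnts is \<Longrightarrow> exec (emit out is) s = s(out := s out @ vals s is)"
proof (induction "is" arbitrary: s)
  case (Cons i "is")
  then have "i \<noteq> Cnt out" "out \<notin> cnts is"
    by (auto simp: cnts_def)
  have IH: "exec (emit out is) s = s(out := s out @ vals s is)" for s
    by (rule Cons.IH) fact
  have "exec (emit out (i # is)) s = exec (emit out is) (s(out := s out @ item_val s i))"
    using \<open>i \<noteq> Cnt out\<close> by (simp add: emit_def exec_emit1)
  also have "\<dots> = s(out := s out @ vals s (i # is))"
    unfolding IH using \<open>out \<notin> cnts is\<close> by simp
  finally have "exec (emit out (i # is)) s = s(out := s out @ vals s (i # is))" .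
  then show ?case
    by simp
qed (simp add: emit_def)

lemma wf_emit [simp]:
  assumes "out < k" "out \<notin> A" "out \<notin> cnts is" "\<And>t. t \<in> cnts is \<Longrightarrow> t < k \<and> t \<notin> A"
  shows "wf_prog k A (emit out is)"
  using assms
proof (induction "is")
  case (Cons i "is")
  then show ?case
    by (cases i) (auto simp: emit_def)
qed (simp add: emit_def)

lemma loops_emit [simp]: "loops (emit out is) = cnts is"
proof (induction "is")
  case (Cons i "is")
  then show ?case
    by (cases i) (auto simp: emit_def)
qed (simp add: emit_def)

text \<open>Tape \<open>v\<close> counts the finished rounds, so an item \<open>Cnt v\<close> prints
  the number of the current round as an exponent of 2.\<close>

definition emit_loop :: "nat \<Rightarrow> nat \<Rightarrow> nat \<Rightarrow> item list \<Rightarrow> item list \<Rightarrow> prog" where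
  "emit_loop out u v is js =
     Loop u (Seq (emit out is) (App v True)) (Seq (emit out js) (App v True))"

lemma exec_emit_loop [simp]:
  assumes "out \<notin> cnts is" "out \<notin> cnts js" "out \<noteq> v"
  shows "exec (emit_loop out u v is js) s = s
     (v := s v @ replicate (length (s u)) True,
      out := s out @ concat (map (\<lambda>i. vals (s(v := s v @ replicate i True)) (if s u ! i then js else is))
        [0..<length (s u)]))"
proof -
  let ?body = "\<lambda>b. if b then exec (Seq (emit out js) (App v True)) else exec (Seq (emit out is) (App v True))"
  let ?vals = "\<lambda>ys i. vals (s(v := s v @ replicate i True)) (if ys ! i then js else is)"
  define st where "st = (\<lambda>ys. s(v := s v @ replicate (length ys) True,
      out := s out @ concat (map (?vals ys) [0..<length ys])))"
  have "fold ?body ys s = st ys" for ys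
  \<comment> \<open>From the right, because the round for the last bit sees a counter raised by all
    the earlier rounds.\<close>
  proof (induction ys rule: rev_induct)
    case Nil
    then show ?case
      using assms by (simp add: st_def)
  next
    case (snoc b ys)
    have eq: "map (?vals (ys @ [b])) [0..<length ys] = map (?vals ys) [0..<length ys]"
      by (intro map_cong) (auto simp: nth_append)
    have out: "st (ys @ [b]) = s(v := s v @ replicate (Suc (length ys)) True,
        out := s out @ concat (map (?vals ys) [0..<length ys]) @
          vals (s(v := s v @ replicate (length ys) True)) (if b then js else is))"
      by (simp add: st_def eq split del: if_split)
    have "fold ?body (ys @ [b]) s = ?body b (st ys)"
      using snoc by simp
    also have "\<dots> = st (ys @ [b])"
      unfolding out using assms by (auto simp: st_def replicate_append_same fun_upd_twist)
    finally show ?case .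
  qed
  then show ?thesis
    by (simp add: emit_loop_def st_def)
qed

lemma wf_emit_loop [simp]:
  assumes "u < k" "u \<notin> A" "v < k" "v \<notin> A" "u \<noteq> v" "out < k" "out \<notin> A" "out \<noteq> u"
    and "out \<notin> cnts is" "\<And>t. t \<in> cnts is \<Longrightarrow> t < k \<and> t \<notin> insert u A"
    and "out \<notin> cnts js" "\<And>t. t \<in> cnts js \<Longrightarrow> t < k \<and> t \<notin> insert u A"
  shows "wf_prog k A (emit_loop out u v is js)"
  using assms by (auto simp: emit_loop_def intro!: wf_emit)

lemma loops_emit_loop [simp]: "loops (emit_loop out u v is js) = insert u (cnts is \<union> cnts js)"
  by (simp add: emit_loop_def)

section \<open>Unary arithmetic on tape lengths\<close>

definition mult_prog :: "nat \<Rightarrow> nat \<Rightarrow> nat \<Rightarrow> prog" where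
  "mult_prog u v w = (let p = Seq (Loop v (App w True) (App w True)) (App w True) in Loop u p p)"

lemma exec_mult_prog [simp]:
  assumes "w \<noteq> v"
  shows "exec (mult_prog u v w) s = s(w := s w @ replicate (length (s u) * (length (s v) + 1)) True)"
proof -
  let ?p = "Seq (Loop v (App w True) (App w True)) (App w True)"
  have p: "exec ?p s = s(w := s w @ replicate (length (s v) + 1) True)" for s
  proof -
    have "fold (\<lambda>b. if b then exec (App w True) else exec (App w True)) ys s =
        s(w := s w @ replicate (length ys) True)" for ys :: "bool list" and s
      by (induction ys arbitrary: s) (auto simp: fun_eq_iff)
    then show ?thesis
      by (simp add: replicate_append_same)
  qed
  have "fold (\<lambda>b. if b then exec ?p else exec ?p) ys s =
      s(w := s w @ replicate (length ys * (length (s v) + 1)) True)" for ys :: "bool list" and s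
  proof (induction ys arbitrary: s)
    case (Cons b ys)
    have "fold (\<lambda>b. if b then exec ?p else exec ?p) (b # ys) s =
        fold (\<lambda>b. if b then exec ?p else exec ?p) ys (s(w := s w @ replicate (length (s v) + 1) True))"
      using p [of s] by simp
    also have "\<dots> = s(w := s w @ replicate (length (b # ys) * (length (s v) + 1)) True)"
    proof -
      have "replicate (length (b # ys) * (length (s v) + 1)) True =
          replicate (length (s v) + 1) True @ replicate (length ys * (length (s v) + 1)) True"
        by (simp only: replicate_add [symmetric] length_Cons mult_Suc)
      then show ?thesis
        unfolding Cons.IH using assms by (simp del: replicate_Suc mult_Suc)
    qed
    finally show ?case .
  qed simp
  then show ?thesis
    by (simp add: mult_prog_def Let_def)
qed

text \<open>Each multiplication by tape 0 contributes a factor \<open>length x + 1\<close>, so tape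
  \<open>5 + i\<close> receives \<open>c * (length x + 1) ^ i\<close> cells. Tapes 1 to 4 stay free
  for the counters of \<open>game_prog\<close>.\<close>

definition pow_prog :: "nat \<Rightarrow> nat \<Rightarrow> prog" where
  "pow_prog c d = Seq (str 5 (replicate c True)) (seqs (map (\<lambda>i. mult_prog (5 + i) 0 (6 + i)) [0..<d]))"

lemma exec_seqs_append: "exec (seqs (ps @ qs)) s = exec (seqs qs) (exec (seqs ps) s)"
  by (induction ps arbitrary: s) auto

lemma exec_pow_prog:
  "exec (pow_prog c d) (start_store x) = (\<lambda>t. if t = 0 then x
     else if 5 \<le> t \<and> t \<le> 5 + d then replicate (c * (length x + 1) ^ (t - 5)) True else [])"
proof (induction d)
  case 0
  show ?case
    by (auto simp: pow_prog_def start_store_def)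
next
  case (Suc d)
  have "exec (pow_prog c (Suc d)) (start_store x) =
      exec (mult_prog (5 + d) 0 (6 + d)) (exec (pow_prog c d) (start_store x))"
    by (simp add: pow_prog_def exec_seqs_append)
  also have "\<dots> = (\<lambda>t. if t = 0 then x
     else if 5 \<le> t \<and> t \<le> 5 + Suc d then replicate (c * (length x + 1) ^ (t - 5)) True else [])"
    unfolding Suc.IH by (auto simp: fun_eq_iff algebra_simps)
  finally show ?case .
qed

lemma wf_seqs: "wf_prog k A (seqs ps) \<longleftrightarrow> (\<forall>p \<in> set ps. wf_prog k A p)"
  by (induction ps) auto

lemma loops_seqs: "loops (seqs ps) = \<Union> (loops ` set ps)"
  by (induction ps) auto

lemma wf_pow_prog: "6 + d \<le> k \<Longrightarrow> wf_prog k {} (pow_prog c d)"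
  by (auto simp: pow_prog_def wf_seqs mult_prog_def Let_def)

lemma loops_pow_prog: "loops (pow_prog c d) \<subseteq> insert 0 {5..<5 + d}"
  by (auto simp: pow_prog_def loops_seqs mult_prog_def Let_def)

text \<open>Vertices and edges relative to two counters, the lengths \<open>l\<close> and \<open>i\<close> of a tape for the
  \<open>Low\<close> chain and a tape for the \<open>Inp\<close> chain. A weight \<open>Inr d\<close> stands for $-2^{l+d}$.\<close>

fun shift :: "nat \<Rightarrow> nat \<Rightarrow> vertex \<Rightarrow> vertex" where
  "shift l i (Low d) = Low (l + d)"
| "shift l i (Inp y d) = Inp y (i + d)"
| "shift l i s = s"

definition node_items :: "nat \<Rightarrow> nat \<Rightarrow> nat \<Rightarrow> item list" where
  "node_items v d t = [Cnt v, Lit (concat (replicate d [True, False]) @ [True, True] @ enc_nat t)]"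

fun vertex_items :: "nat \<Rightarrow> nat \<Rightarrow> vertex \<Rightarrow> item list" where
  "vertex_items lt it (Low d) = node_items lt d 0"
| "vertex_items lt it (Inp y d) = node_items it d (3 + 2 * y)"
| "vertex_items lt it s = [Lit (enc_nat (code s))]"

fun shift_weight :: "nat \<Rightarrow> int + nat \<Rightarrow> int" where
  "shift_weight l (Inl w) = w"
| "shift_weight l (Inr d) = - (2 ^ (l + d))"

fun weight_items :: "nat \<Rightarrow> int + nat \<Rightarrow> item list" where
  "weight_items lt (Inl w) = [Lit (enc_int w)]"
| "weight_items lt (Inr d) = Lit [True] # node_items lt d 0"

fun shift_edge :: "nat \<Rightarrow> nat \<Rightarrow> vertex \<times> (int + nat) \<times> vertex \<Rightarrow> vertex \<times> int \<times> vertex" where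
  "shift_edge l i (s, w, t) = (shift l i s, shift_weight l w, shift l i t)"

fun edge_items :: "nat \<Rightarrow> nat \<Rightarrow> vertex \<times> (int + nat) \<times> vertex \<Rightarrow> item list" where
  "edge_items lt it (s, w, t) = vertex_items lt it s @ weight_items lt w @ vertex_items lt it t"

definition enc_vertices :: "vertex list \<Rightarrow> bool list" where
  "enc_vertices vs = concat (map (\<lambda>s. True # enc_nat (code s)) vs)"

definition enc_edges :: "(vertex \<times> int \<times> vertex) list \<Rightarrow> bool list" where
  "enc_edges es = concat (map (\<lambda>(s, w, t). True # enc_edge (code s, w, code t)) es)"

lemma enc_vertices_append: "enc_vertices (vs @ ws) = enc_vertices vs @ enc_vertices ws"
  by (simp add: enc_vertices_def)

lemma enc_edges_append: "enc_edges (es @ fs) = enc_edges es @ enc_edges fs"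
  by (simp add: enc_edges_def)

lemma enc_vertices_concat: "enc_vertices (concat (map g xs)) = concat (map (\<lambda>k. enc_vertices (g k)) xs)"
  by (induction xs) (simp_all add: enc_vertices_def)

lemma enc_edges_concat: "enc_edges (concat (map g xs)) = concat (map (\<lambda>k. enc_edges (g k)) xs)"
  by (induction xs) (simp_all add: enc_edges_def)

definition vertices_items :: "nat \<Rightarrow> nat \<Rightarrow> vertex list \<Rightarrow> item list" where
  "vertices_items lt it vs = concat (map (\<lambda>s. Lit [True] # vertex_items lt it s) vs)"

definition edges_items :: "nat \<Rightarrow> nat \<Rightarrow> (vertex \<times> (int + nat) \<times> vertex) list \<Rightarrow> item list" where
  "edges_items lt it es = concat (map (\<lambda>e. Lit [True] # edge_items lt it e) es)"

lemma vals_node_items [simp]: "vals s (node_items v d t) = enc_nat (node t (length (s v) + d))"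
  by (simp add: node_items_def enc_nat_node replicate_add)

lemma cnts_node_items [simp]: "cnts (node_items v d t) = {v}"
  by (simp add: node_items_def)

lemma vals_vertex_items [simp]:
  "vals s (vertex_items lt it v) = enc_nat (code (shift (length (s lt)) (length (s it)) v))"
  by (cases v) simp_all

lemma cnts_vertex_items: "cnts (vertex_items lt it v) \<subseteq> {lt, it}"
  by (cases v) simp_all

lemma vals_weight_items [simp]: "vals s (weight_items lt w) = enc_int (shift_weight (length (s lt)) w)"
  by (cases w) (simp_all add: enc_int_uminus_power)

lemma cnts_weight_items: "cnts (weight_items lt w) \<subseteq> {lt}"
  by (cases w) simp_all

lemma vals_vertices_items [simp]: "vals s (vertices_items lt it vs) =
    enc_vertices (map (shift (length (s lt)) (length (s it))) vs)"
  by (induction vs) (simp_all add: vertices_items_def enc_vertices_def)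

lemma cnts_vertices_items: "cnts (vertices_items lt it vs) \<subseteq> {lt, it}"
  using cnts_vertex_items by (induction vs) (fastforce simp: vertices_items_def)+

lemma vals_edges_items [simp]: "vals s (edges_items lt it es) =
    enc_edges (map (shift_edge (length (s lt)) (length (s it))) es)"
  by (induction es)
    (auto simp: edges_items_def enc_edges_def enc_edge_def src_def weight_def tgt_def)

lemma cnts_edges_items: "cnts (edges_items lt it es) \<subseteq> {lt, it}"
  using cnts_vertex_items cnts_weight_items
  by (induction es) (fastforce simp: edges_items_def)+

lemma not_in_cnts [simp]:
  assumes "t \<noteq> lt" "t \<noteq> it"
  shows "t \<notin> cnts (vertices_items lt it vs)" "t \<notin> cnts (edges_items lt it es)"
  using assms cnts_vertices_items cnts_edges_items by blast+

lemma in_cnts: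
  "t \<in> cnts (vertices_items lt it vs) \<Longrightarrow> t = lt \<or> t = it"
  "t \<in> cnts (edges_items lt it es) \<Longrightarrow> t = lt \<or> t = it"
  using cnts_vertices_items cnts_edges_items by blast+

section \<open>The program that prints the game\<close>

context ca_game_data
begin

text \<open>The edges at one input position, relative to the counter, as a function of the bit read
  there.\<close>

definition bit_edges :: "bool \<Rightarrow> (vertex \<times> (int + nat) \<times> vertex) list" where
  "bit_edges b = (Inp (sym b) 0, Inl (-1), Sink) #
     concat (map (\<lambda>y. [(Inp y 0, Inl 0, Inp y 0), (Inp y 0, Inl (-2), Inp y 1)]) ys)"

definition last_edges :: "(vertex \<times> (int + nat) \<times> vertex) list" where
  "last_edges = map (\<lambda>y. (Inp y 0, Inl 0, Inp y 0)) ys @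
     (Inp blk 0, Inl 0, Low 0) # (Claim blk, Inr 1, Low 0) #
     concat (map (\<lambda>a. concat (map (\<lambda>b. map (\<lambda>c. (Claim (F a b c), Inr 2, Tri a b c)) al) al)) al)"

text \<open>Tape \<open>u\<close> holds \<open>m\<close> in unary. Tapes 1 and 2 count along the
  chains of vertices; a counter cannot be reset, so the edges use tapes 3 and 4. Neither
  \<open>x\<close> nor \<open>m\<close> occurs in the program, which therefore is the same for all
  inputs. The single bits \<open>False\<close> close the lists.\<close>

definition game_prog :: "nat \<Rightarrow> nat \<Rightarrow> bool list \<Rightarrow> prog" where
  "game_prog u out suffix = seqs [
     emit out (vertices_items 1 2 (Ini # Go # Sink # map Claim al)),
     emit_loop out u 1 (vertices_items 1 2 [Low 0]) (vertices_items 1 2 [Low 0]),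
     emit out (vertices_items 1 2 [Low 0]),
     emit_loop out 0 2 (vertices_items 1 2 (map (\<lambda>y. Inp y 0) ys))
       (vertices_items 1 2 (map (\<lambda>y. Inp y 0) ys)),
     emit out (vertices_items 1 2 (map (\<lambda>y. Inp y 0) ys)),
     str out ([False] @ enc_list enc_nat (map code vs1) @ enc_edges const_edges),
     emit_loop out u 3 (edges_items 3 4 [(Low 1, Inl 0, Low 0), (Low 1, Inr 1, Low 0)])
       (edges_items 3 4 [(Low 1, Inl 0, Low 0), (Low 1, Inr 1, Low 0)]),
     emit_loop out 0 4 (edges_items 3 4 (bit_edges False)) (edges_items 3 4 (bit_edges True)),
     emit out (edges_items 3 4 last_edges),
     str out ([False] @ enc_nat (code Ini) @ suffix)]"

text \<open>The encoding is cut into the pieces printed by \<open>game_prog\<close>. The last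
  members of both chains are separate, since the loops stop short of the indices \<open>m\<close>
  and \<open>length x\<close>.\<close>

lemma enc_input_game: "enc_game input_game =
    enc_vertices (Ini # Go # Sink # map Claim al) @
    concat (map (\<lambda>k. enc_vertices [Low k]) [0..<m]) @ enc_vertices [Low m] @
    concat (map (\<lambda>j. enc_vertices (map (\<lambda>y. Inp y j) ys)) [0..<length x]) @
    enc_vertices (map (\<lambda>y. Inp y (length x)) ys) @
    [False] @ enc_list enc_nat (map code vs1) @ enc_edges const_edges @
    enc_edges low_edges @ enc_edges inp_edges @ enc_edges tall_edges @ [False]"
proof -
  have V: "enc_list enc_nat (map code vs) = enc_vertices vs @ [False]" for vs
    by (simp add: enc_list_eq enc_vertices_def o_def)
  have E: "enc_list enc_edge (map (\<lambda>(s, w, t). (code s, w, code t)) es) = enc_edges es @ [False]" for es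
    unfolding enc_list_eq enc_edges_def map_map
    by (intro arg_cong2 [where f = "(@)"] arg_cong [where f = concat] map_cong) auto
  have Low: "enc_vertices (map Low [0..<m]) = concat (map (\<lambda>k. enc_vertices [Low k]) [0..<m])"
    using enc_vertices_concat [of "\<lambda>k. [Low k]" "[0..<m]"] by (simp add: concat_map_singleton)
  have "vs0 = (Ini # Go # Sink # map Claim al) @ map Low [0..<m] @ [Low m] @
      concat (map (\<lambda>j. map (\<lambda>y. Inp y j) ys) [0..<length x]) @ map (\<lambda>y. Inp y (length x)) ys"
    by (simp add: vs0_def)
  then have "enc_list enc_nat (map code vs0) = enc_vertices (Ini # Go # Sink # map Claim al) @
    concat (map (\<lambda>k. enc_vertices [Low k]) [0..<m]) @ enc_vertices [Low m] @
    concat (map (\<lambda>j. enc_vertices (map (\<lambda>y. Inp y j) ys)) [0..<length x]) @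
    enc_vertices (map (\<lambda>y. Inp y (length x)) ys) @ [False]"
    by (simp only: V enc_vertices_append enc_vertices_concat Low append_assoc)
  then show ?thesis
    unfolding input_game_def enc_game.simps E by (simp add: es_def enc_edges_append)
qed

lemma exec_game_prog:
  assumes s: "s 0 = x" "length (s u) = m" "s 1 = []" "s 2 = []" "s 3 = []" "s 4 = []" "s out = []"
    and u: "u > 4" "out > 4" "out \<noteq> u"
  shows "exec (game_prog u out suffix) s = s(1 := replicate m True, 2 := replicate (length x) True,
     3 := replicate m True, 4 := replicate (length x) True,
     out := enc_game input_game @ enc_nat (code Ini) @ suffix)"
proof -
  have low: "concat (map (\<lambda>k. enc_edges (map (shift_edge k i) [(Low 1, Inl 0, Low 0), (Low 1, Inr 1, Low 0)])) [0..<m]) =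
      enc_edges low_edges" for i
    by (simp add: low_edges_def enc_edges_concat)
  have bit: "map (shift_edge l j) (bit_edges b) = (Inp (sym b) j, -1, Sink) #
      concat (map (\<lambda>y. [(Inp y j, 0, Inp y j), (Inp y j, -2, Inp y (Suc j))]) ys)" for l j b
    by (simp add: bit_edges_def map_concat o_def)
  have last: "map (shift_edge m (length x)) last_edges =
      map (\<lambda>y. (Inp y (length x), 0, Inp y (length x))) ys @ tall_edges"
    by (simp add: last_edges_def tall_edges_def map_concat o_def)
  have inp: "enc_edges inp_edges @ enc_edges tall_edges @ z =
      concat (map (\<lambda>j. enc_edges (map (shift_edge m j) (bit_edges (x ! j)))) [0..<length x]) @
      enc_edges (map (shift_edge m (length x)) last_edges) @ z" for z
    unfolding last bit by (simp add: inp_edges_def enc_edges_concat enc_edges_append)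
  have if_items: "vals \<sigma> (if b then edges_items 3 4 (bit_edges True) else edges_items 3 4 (bit_edges False)) =
      vals \<sigma> (edges_items 3 4 (bit_edges b))" for \<sigma> b
    by simp
  show ?thesis
    unfolding enc_input_game append_assoc inp low [of 0, symmetric]
    using s u
    by (simp add: game_prog_def if_items fun_upd_twist o_def del: enc_list.simps code.simps)
qed

lemma wf_game_prog:
  assumes "out < k" "u < out" "4 < u"
  shows "wf_prog k {} (game_prog u out suffix)"
  using assms by (auto simp: game_prog_def intro!: wf_emit wf_emit_loop dest!: in_cnts)

lemma loops_game_prog: "loops (game_prog u out suffix) \<subseteq> {0, 1, 2, 3, 4, u}"
  by (auto simp: game_prog_def dest!: in_cnts)

end

section \<open>Assembling the reduction\<close>

lemma poly_le_monomial:
  fixes p :: "nat poly"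
  shows "\<exists>c d. \<forall>n. poly p n \<le> c * (n + 1) ^ d"
proof (induction p)
  case 0
  then show ?case
    by auto
next
  case (pCons a p)
  then obtain c d where cd: "\<And>n. poly p n \<le> c * (n + 1) ^ d"
    by blast
  have "poly (pCons a p) n \<le> (a + c) * (n + 1) ^ Suc d" for n
  proof -
    have "1 \<le> (n + 1) ^ Suc d"
      by (rule one_le_power) simp
    then have "a * 1 \<le> a * (n + 1) ^ Suc d"
      by (rule mult_le_mono2)
    moreover have "n * poly p n \<le> (n + 1) * (c * (n + 1) ^ d)"
      using cd by (intro mult_le_mono) auto
    ultimately show ?thesis
      by (simp add: algebra_simps)
  qed
  then show ?case
    by blast
qed

text \<open>The word \<open>suffix\<close> leaves room for an encoded threshold and is empty when
  the threshold is fixed.\<close>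

lemma EXPSPACE_reduction:
  assumes "A \<in> EXPSPACE"
  shows "\<exists>f. polytime f \<and> (\<forall>x. \<exists>g s. f x = enc_game g @ enc_nat s @ suffix \<and>
    weighted_game (game_of g) \<and> s \<in> states (game_of g) \<and>
    (x \<in> A \<longleftrightarrow> P0_wins (game_of g) s (AEL (game_of g) 0)))"
proof -
  from assms obtain M and p :: "nat poly" where M: "turing_machine M" "num_tapes M = 1"
      "decides M A" "space_bounded M (\<lambda>n. 2 ^ poly p n)"
    by (auto simp: EXPSPACE_def)
  obtain c0 d0 where cd0: "\<And>n. poly p n \<le> c0 * (n + 1) ^ d0"
    using poly_le_monomial by blast
  \<comment> \<open>Raising \<open>c0\<close> by 2 and \<open>d0\<close> by 1 makes
    \<open>m x\<close> exceed \<open>length x + 2\<close> as well as the exponent of the space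
    bound.\<close>
  define c d where "c = c0 + 2" and "d = Suc d0"
  define m :: "bool list \<Rightarrow> nat" where "m = (\<lambda>x. c * (length x + 1) ^ d)"
  have m: "poly p (length x) \<le> m x" "length x + 2 \<le> m x" for x
  proof -
    have "c0 * (length x + 1) ^ d0 \<le> c * (length x + 1) ^ d"
      by (intro mult_le_mono power_increasing) (auto simp: c_def d_def)
    with cd0 [of "length x"] show "poly p (length x) \<le> m x"
      by (simp add: m_def)
    have "length x + 2 \<le> 2 * (length x + 1) ^ 1"
      by simp
    also have "\<dots> \<le> m x"
      unfolding m_def by (intro mult_le_mono power_increasing) (auto simp: c_def d_def)
    finally show "length x + 2 \<le> m x" .
  qed
  \<comment> \<open>After \<open>pow_prog\<close>, tape \<open>5 + d\<close> holds
    \<open>m x\<close> in unary; tape \<open>6 + d\<close> is the output.\<close>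
  define P where "P = Seq (pow_prog c d) (ca_game_data.game_prog (tsyms M) (acc_syms M)
    (local_rule M) blank_sym start_sym bit_sym (5 + d) (6 + d) suffix)"
  define f where "f = (\<lambda>x. exec P (start_store x) (6 + d))"
  define g where "g = (\<lambda>x. ca_game_data.input_game (tsyms M) (acc_syms M)
    (local_rule M) blank_sym start_sym bit_sym x (m x))"
  have exec_P: "exec P (start_store x) = (exec (pow_prog c d) (start_store x))
     (1 := replicate (m x) True, 2 := replicate (length x) True, 3 := replicate (m x) True,
      4 := replicate (length x) True, 6 + d := enc_game (g x) @ enc_nat (code Ini) @ suffix)" for x
    unfolding P_def exec.simps g_def
    by (rule ca_game_data.exec_game_prog) (auto simp: exec_pow_prog m_def)
  have "polytime f"
    unfolding f_def
  proof (rule polytime_exec)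
    show "wf_prog (Suc (6 + d)) {} P"
      by (simp add: P_def wf_pow_prog ca_game_data.wf_game_prog d_def)
  next
    fix x :: "bool list" and t
    assume "t \<in> loops P"
    then have "t < 6 + d"
      using loops_pow_prog ca_game_data.loops_game_prog by (fastforce simp: P_def)
    then have "(length x + 1) ^ (t - 5) \<le> (length x + 1) ^ d"
      by (intro power_increasing) auto
    \<comment> \<open>The loops run over the input, the counters and the powers, whose lengths are
      at most \<open>length x\<close> or \<open>m x\<close>.\<close>
    then show "length (exec P (start_store x) t) \<le>
        poly ([:c:] * [:1, 1:] ^ d + [:0, 1:]) (length x)"
      using \<open>t < 6 + d\<close> unfolding exec_P
      by (auto simp: exec_pow_prog m_def intro!: trans_le_add1 mult_le_mono2)
  qed
  moreover have "\<exists>g s. f x = enc_game g @ enc_nat s @ suffix \<and>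
      weighted_game (game_of g) \<and> s \<in> states (game_of g) \<and>
      (x \<in> A \<longleftrightarrow> P0_wins (game_of g) s (AEL (game_of g) 0))" for x
  proof -
    interpret tm_game M "\<lambda>n. 2 ^ poly p n" x "m x"
    proof
      have "m x < 2 ^ m x"
        by (rule less_exp)
      then show "length x + 2 \<le> 2 ^ m x"
        using m(2) [of x] by linarith
      show "(2::nat) ^ poly p (length x) \<le> 2 ^ m x"
        using m(1) by (intro power_increasing) auto
      show "1 \<le> m x"
        using m(2) [of x] by linarith
    qed (use M in auto)
    have g: "g x = input_game"
      by (simp add: g_def)
    have "x \<in> A \<longleftrightarrow> P0_wins (game_of (g x)) (code Ini) (AEL (game_of (g x)) 0)"
      unfolding g P0_wins_iff cell_acc_iff by (rule decides_iff_accepts) fact+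
    moreover have "f x = enc_game (g x) @ enc_nat (code Ini) @ suffix"
      unfolding f_def exec_P by simp
    ultimately show ?thesis
      using weighted_game_G Ini_state unfolding g by blast
  qed
  ultimately show ?thesis
    by blast
qed

lemma enc_nat_inject: "enc_nat m = enc_nat n \<longleftrightarrow> m = n"
  using enc_nat_prefix_free [of m "[]" n "[]"] by simp

theorem theorem2:
  shows "EXPSPACE_hard AEL_threshold_problem \<and> EXPSPACE_hard (AEL_threshold_problem_at 0)"
proof
  show "EXPSPACE_hard AEL_threshold_problem"
    unfolding EXPSPACE_hard_def
  proof
    fix A assume "A \<in> EXPSPACE"
    \<comment> \<open>The suffix encodes the threshold as the fraction \<open>0 / 1\<close>.\<close>
    from EXPSPACE_reduction [OF this, of "enc_nat 0 @ enc_nat 1"] obtain f where f: "polytime f"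
      "\<And>x. \<exists>g s. f x = enc_game g @ enc_nat s @ enc_nat 0 @ enc_nat 1 \<and>
        weighted_game (game_of g) \<and> s \<in> states (game_of g) \<and>
        (x \<in> A \<longleftrightarrow> P0_wins (game_of g) s (AEL (game_of g) 0))"
      by blast
    have "x \<in> A \<longleftrightarrow> f x \<in> AEL_threshold_problem" for x
    proof -
      obtain g s where gs: "f x = enc_game g @ enc_nat s @ enc_nat 0 @ enc_nat 1"
        "weighted_game (game_of g)" "s \<in> states (game_of g)"
        "x \<in> A \<longleftrightarrow> P0_wins (game_of g) s (AEL (game_of g) 0)"
        using f(2) by blast
      \<comment> \<open>Unique decoding leaves this game, vertex and threshold as the only possible
        witnesses of membership.\<close>
      have "f x \<in> AEL_threshold_problem \<longleftrightarrow>
          P0_wins (game_of g) s (AEL (game_of g) (of_nat 0 / of_nat 1))"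
        unfolding AEL_threshold_problem_def gs(1) mem_Collect_eq
          enc_game_prefix_free enc_nat_prefix_free enc_nat_inject
        using gs(2,3) by blast
      then show ?thesis
        using gs(4) by simp
    qed
    then show "polytime_reducible A AEL_threshold_problem"
      using f(1) unfolding polytime_reducible_def by blast
  qed
  show "EXPSPACE_hard (AEL_threshold_problem_at 0)"
    unfolding EXPSPACE_hard_def
  proof
    fix A assume "A \<in> EXPSPACE"
    from EXPSPACE_reduction [OF this, of "[]"] obtain f where f: "polytime f"
      "\<And>x. \<exists>g s. f x = enc_game g @ enc_nat s @ [] \<and>
        weighted_game (game_of g) \<and> s \<in> states (game_of g) \<and>
        (x \<in> A \<longleftrightarrow> P0_wins (game_of g) s (AEL (game_of g) 0))"
      by blast
    have "x \<in> A \<longleftrightarrow> f x \<in> AEL_threshold_problem_at 0" for x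
    proof -
      obtain g s where gs: "f x = enc_game g @ enc_nat s"
        "weighted_game (game_of g)" "s \<in> states (game_of g)"
        "x \<in> A \<longleftrightarrow> P0_wins (game_of g) s (AEL (game_of g) 0)"
        using f(2) [of x] by auto
      have "f x \<in> AEL_threshold_problem_at 0 \<longleftrightarrow> P0_wins (game_of g) s (AEL (game_of g) 0)"
        unfolding AEL_threshold_problem_at_def gs(1) mem_Collect_eq
          enc_game_prefix_free enc_nat_inject
        using gs(2,3) by blast
      then show ?thesis
        using gs(4) by simp
    qed
    then show "polytime_reducible A (AEL_threshold_problem_at 0)"
      using f(1) unfolding polytime_reducible_def by blast
  qed
qed

end
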